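(* There is an algorithm that, given a graph $G$ of order $n$, enumerates all locally minimal defensive alliances of $G$ in time $\mathcal{O}^*(2^n)$. This is optimal, even on very restricted graphs: there is an infinite family of graphs, each of which is a complete bipartite graph with pathwidth $2$, treewidth $2$, neighborhood diversity $2$, vertex cover number $2$, cliquewidth $2$ (i.e., it is a cograph), twin-cover number $2$ and treedepth $3$, such that the number of locally minimal defensive alliances of a member of order $n$ is at least $2^n/p(n)$ for some fixed polynomial $p$ (so that every enumeration algorithm needs at least this many steps).
   Context: Graphs are finite, simple and undirected. For $G=(V,E)$, $X\subseteq V$ and $v\in V$, $\deg_X(v)$ is the number of neighbors of $v$ in $X$, and $\overline{X}=V\setminus X$. A set $A\subseteq V$ is a defensive alliance if $\deg_A(v)+1\ge \deg_{\overline{A}}(v)$ for every $v\in A$. A non-empty defensive alliance $A$ is locally minimal if for no $v\in A$ the set $A\setminus\{v\}$ is a non-empty defensive alliance. $\mathcal{O}^*$ suppresses factors polynomial in $n$. Neighborhood diversity: the number of equivalence classes of the relation on $V$ where $u,v$ are equivalent iff $N(v)\setminus\{u\}=N(u)\setminus\{v\}$. Twin-cover number: the minimum size of a set $X\subseteq V$ such that for every edge $\{u,v\}$, either $u\in X$ or $v\in X$ or $N[u]=N[v]$. Treedepth: the minimum depth (maximum number of vertices on a root-to-leaf path) of a rooted forest $F$ on vertex set $V$ such that for every edge $\{u,v\}$ of $G$ one of $u,v$ is an ancestor of the other in $F$. Vertex cover number: minimum size of a vertex cover. Pathwidth, treewidth and cliquewidth are standard. *)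

theory Defs
  imports Complex_Main "HOL-Library.Landau_Symbols" "HOL-Computational_Algebra.Polynomial"
begin

section \<open>Finite simple undirected graphs\<close>

type_synonym 'a graph = "'a set \<times> 'a set set"

abbreviation verts :: "'a graph \<Rightarrow> 'a set" where "verts G \<equiv> fst G"
abbreviation edges :: "'a graph \<Rightarrow> 'a set set" where "edges G \<equiv> snd G"

definition simple_graph :: "'a graph \<Rightarrow> bool" where
  "simple_graph G \<longleftrightarrow>
     finite (verts G) \<and>
     (\<forall>e\<in>edges G. \<exists>u v. u \<in> verts G \<and> v \<in> verts G \<and> u \<noteq> v \<and> e = {u, v})"

definition gorder :: "'a graph \<Rightarrow> nat" where
  "gorder G = card (verts G)"

definition adj :: "'a graph \<Rightarrow> ('a \<times> 'a) set" where
  "adj G = {(u, v). {u, v} \<in> edges G}"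

definition nbh :: "'a graph \<Rightarrow> 'a \<Rightarrow> 'a set" where
  "nbh G v = {u \<in> verts G. {u, v} \<in> edges G}"

definition closed_nbh :: "'a graph \<Rightarrow> 'a \<Rightarrow> 'a set" where
  "closed_nbh G v = insert v (nbh G v)"

definition induced :: "'a graph \<Rightarrow> 'a set \<Rightarrow> 'a graph" where
  "induced G X = (verts G \<inter> X, {e \<in> edges G. e \<subseteq> X})"

definition graph_connected :: "'a graph \<Rightarrow> bool" where
  "graph_connected G \<longleftrightarrow>
     verts G \<noteq> {} \<and> (\<forall>u\<in>verts G. \<forall>v\<in>verts G. (u, v) \<in> (adj G)\<^sup>*)"

definition graph_cycle :: "'a graph \<Rightarrow> 'a list \<Rightarrow> bool" where
  "graph_cycle G c \<longleftrightarrow>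
     3 \<le> length c \<and> distinct c \<and>
     (\<forall>i<length c. (c ! i, c ! (Suc i mod length c)) \<in> adj G)"

definition tree :: "'a graph \<Rightarrow> bool" where
  "tree G \<longleftrightarrow> simple_graph G \<and> graph_connected G \<and> (\<nexists>c. graph_cycle G c)"

definition complete_bipartite :: "'a graph \<Rightarrow> bool" where
  "complete_bipartite G \<longleftrightarrow>
     (\<exists>A B. A \<noteq> {} \<and> B \<noteq> {} \<and> A \<inter> B = {} \<and> verts G = A \<union> B \<and>
            edges G = {{a, b} | a b. a \<in> A \<and> b \<in> B})"

section \<open>Defensive alliances\<close>

definition deg_in :: "'a graph \<Rightarrow> 'a set \<Rightarrow> 'a \<Rightarrow> nat" where
  "deg_in G X v = card (nbh G v \<inter> X)"

definition defensive_alliance :: "'a graph \<Rightarrow> 'a set \<Rightarrow> bool" where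
  "defensive_alliance G A \<longleftrightarrow>
     A \<subseteq> verts G \<and> (\<forall>v\<in>A. deg_in G A v + 1 \<ge> deg_in G (verts G - A) v)"

definition loc_min_defensive_alliance :: "'a graph \<Rightarrow> 'a set \<Rightarrow> bool" where
  "loc_min_defensive_alliance G A \<longleftrightarrow>
     A \<noteq> {} \<and> defensive_alliance G A \<and>
     \<not> (\<exists>v\<in>A. A - {v} \<noteq> {} \<and> defensive_alliance G (A - {v}))"

definition loc_min_defensive_alliances :: "'a graph \<Rightarrow> 'a set set" where
  "loc_min_defensive_alliances G = {A. loc_min_defensive_alliance G A}"

section \<open>Graph parameters\<close>

definition twin_rel :: "'a graph \<Rightarrow> ('a \<times> 'a) set" where
  "twin_rel G = {(u, v). u \<in> verts G \<and> v \<in> verts G \<and> nbh G v - {u} = nbh G u - {v}}"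

definition neighborhood_diversity :: "'a graph \<Rightarrow> nat" where
  "neighborhood_diversity G = card (verts G // twin_rel G)"

definition vertex_cover :: "'a graph \<Rightarrow> 'a set \<Rightarrow> bool" where
  "vertex_cover G X \<longleftrightarrow>
     X \<subseteq> verts G \<and> (\<forall>u v. {u, v} \<in> edges G \<longrightarrow> u \<in> X \<or> v \<in> X)"

definition vertex_cover_number :: "'a graph \<Rightarrow> nat" where
  "vertex_cover_number G = (LEAST k. \<exists>X. vertex_cover G X \<and> card X = k)"

definition twin_cover :: "'a graph \<Rightarrow> 'a set \<Rightarrow> bool" where
  "twin_cover G X \<longleftrightarrow>
     X \<subseteq> verts G \<and>
     (\<forall>u v. {u, v} \<in> edges G \<longrightarrow> u \<in> X \<or> v \<in> X \<or> closed_nbh G u = closed_nbh G v)"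

definition twin_cover_number :: "'a graph \<Rightarrow> nat" where
  "twin_cover_number G = (LEAST k. \<exists>X. twin_cover G X \<and> card X = k)"

text \<open>A rooted forest on \<open>V\<close> is given by its parent relation: \<open>(v, u) \<in> P\<close> means that \<open>u\<close> is the
  parent of \<open>v\<close>. The vertices on the path from \<open>v\<close> up to its root are then \<open>P\<^sup>* `` {v}\<close>, and the
  longest such paths start at leaves.\<close>

definition rooted_forest :: "'a set \<Rightarrow> ('a \<times> 'a) set \<Rightarrow> bool" where
  "rooted_forest V P \<longleftrightarrow> P \<subseteq> V \<times> V \<and> single_valued P \<and> acyclic P"

definition forest_depth :: "'a set \<Rightarrow> ('a \<times> 'a) set \<Rightarrow> nat" where
  "forest_depth V P = Max (insert 0 ((\<lambda>v. card (P\<^sup>* `` {v})) ` V))"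

definition elimination_forest :: "'a graph \<Rightarrow> ('a \<times> 'a) set \<Rightarrow> bool" where
  "elimination_forest G P \<longleftrightarrow>
     rooted_forest (verts G) P \<and>
     (\<forall>u v. {u, v} \<in> edges G \<longrightarrow> (u, v) \<in> P\<^sup>+ \<or> (v, u) \<in> P\<^sup>+)"

definition treedepth :: "'a graph \<Rightarrow> nat" where
  "treedepth G =
     (LEAST k. \<exists>P. elimination_forest G P \<and> forest_depth (verts G) P = k)"

definition tree_decomposition :: "'a graph \<Rightarrow> nat graph \<Rightarrow> (nat \<Rightarrow> 'a set) \<Rightarrow> bool" where
  "tree_decomposition G T B \<longleftrightarrow>
     tree T \<and>
     (\<Union>t\<in>verts T. B t) = verts G \<and>
     (\<forall>e\<in>edges G. \<exists>t\<in>verts T. e \<subseteq> B t) \<and>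
     (\<forall>v\<in>verts G. graph_connected (induced T {t. v \<in> B t}))"

definition tree_decomposition_width :: "nat graph \<Rightarrow> (nat \<Rightarrow> 'a set) \<Rightarrow> nat" where
  "tree_decomposition_width T B = Max ((\<lambda>t. card (B t)) ` verts T) - 1"

definition treewidth :: "'a graph \<Rightarrow> nat" where
  "treewidth G =
     (LEAST k. \<exists>T B. tree_decomposition G T B \<and> tree_decomposition_width T B = k)"

definition path_decomposition :: "'a graph \<Rightarrow> 'a set list \<Rightarrow> bool" where
  "path_decomposition G Bs \<longleftrightarrow>
     Bs \<noteq> [] \<and>
     \<Union> (set Bs) = verts G \<and>
     (\<forall>e\<in>edges G. \<exists>B\<in>set Bs. e \<subseteq> B) \<and>
     (\<forall>i j k. i \<le> j \<longrightarrow> j \<le> k \<longrightarrow> k < length Bs \<longrightarrow> Bs ! i \<inter> Bs ! k \<subseteq> Bs ! j)"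

definition path_decomposition_width :: "'a set list \<Rightarrow> nat" where
  "path_decomposition_width Bs = Max (card ` set Bs) - 1"

definition pathwidth :: "'a graph \<Rightarrow> nat" where
  "pathwidth G = (LEAST k. \<exists>Bs. path_decomposition G Bs \<and> path_decomposition_width Bs = k)"

text \<open>\<open>cw_constructible k G l\<close>: the graph \<open>G\<close> with vertex labelling \<open>l\<close> is the value of a
  \<open>k\<close>-expression. Only the values of \<open>l\<close> on \<open>verts G\<close> matter.\<close>

inductive cw_constructible :: "nat \<Rightarrow> 'a graph \<Rightarrow> ('a \<Rightarrow> nat) \<Rightarrow> bool" for k :: nat where
  single: "i < k \<Longrightarrow> cw_constructible k ({v}, {}) (\<lambda>_. i)"
| union: "\<lbrakk>cw_constructible k (V1, E1) l1; cw_constructible k (V2, E2) l2; V1 \<inter> V2 = {}\<rbrakk>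
    \<Longrightarrow> cw_constructible k (V1 \<union> V2, E1 \<union> E2) (\<lambda>v. if v \<in> V1 then l1 v else l2 v)"
| join: "\<lbrakk>cw_constructible k (V, E) l; i < k; j < k; i \<noteq> j\<rbrakk>
    \<Longrightarrow> cw_constructible k
          (V, E \<union> {{u, v} | u v. u \<in> V \<and> v \<in> V \<and> l u = i \<and> l v = j}) l"
| relabel: "\<lbrakk>cw_constructible k (V, E) l; i < k; j < k\<rbrakk>
    \<Longrightarrow> cw_constructible k (V, E) (\<lambda>v. if l v = i then j else l v)"

definition cliquewidth :: "'a graph \<Rightarrow> nat" where
  "cliquewidth G = (LEAST k. \<exists>l. cw_constructible k G l)"

inductive cograph :: "'a graph \<Rightarrow> bool" where
  single: "cograph ({v}, {})"
| union: "\<lbrakk>cograph (V1, E1); cograph (V2, E2); V1 \<inter> V2 = {}\<rbrakk>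
    \<Longrightarrow> cograph (V1 \<union> V2, E1 \<union> E2)"
| complement: "cograph (V, E)
    \<Longrightarrow> cograph (V, {{u, v} | u v. u \<in> V \<and> v \<in> V \<and> u \<noteq> v} - E)"

section \<open>Algorithms\<close>

text \<open>The machine model is the successor random access machine with structured control flow: finitely
  many registers (those a program mentions), an unbounded random access memory, and an append-only
  output. Registers and memory cells hold natural numbers, every instruction and every test takes
  one step, and the only arithmetic is adding and subtracting \<open>1\<close>. Hence within \<open>t\<close> steps no
  number grows by more than \<open>t\<close> beyond the constants of the program and the numbers of the input,
  so that unit cost is an honest measure also of the bit complexity, up to factors polynomial in
  \<open>log t\<close> and the size of the input.\<close>

type_synonym reg = nat

datatype com =
    Const reg nat
  | Copy reg reg
  | Incr reg
  | Decr reg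
  | Load reg reg
  | Store reg reg
  | Output reg
  | Seq com com
  | If_Less reg reg com com
  | While_Less reg reg com

text \<open>Register contents, memory contents, and the output produced so far.\<close>

type_synonym state = "(reg \<Rightarrow> nat) \<times> (nat \<Rightarrow> nat) \<times> nat list"

text \<open>\<open>exec c s t s'\<close>: started in \<open>s\<close>, the program \<open>c\<close> halts in \<open>s'\<close> after exactly \<open>t\<close> steps.\<close>

inductive exec :: "com \<Rightarrow> state \<Rightarrow> nat \<Rightarrow> state \<Rightarrow> bool" where
  Const: "exec (Const x k) (r, m, out) 1 (r(x := k), m, out)"
| Copy: "exec (Copy x y) (r, m, out) 1 (r(x := r y), m, out)"
| Incr: "exec (Incr x) (r, m, out) 1 (r(x := r x + 1), m, out)"
| Decr: "exec (Decr x) (r, m, out) 1 (r(x := r x - 1), m, out)"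
| Load: "exec (Load x y) (r, m, out) 1 (r(x := m (r y)), m, out)"
| Store: "exec (Store x y) (r, m, out) 1 (r, m(r x := r y), out)"
| Output: "exec (Output x) (r, m, out) 1 (r, m, out @ [r x])"
| Seq: "\<lbrakk>exec c1 s1 t1 s2; exec c2 s2 t2 s3\<rbrakk> \<Longrightarrow> exec (Seq c1 c2) s1 (t1 + t2) s3"
| If_True: "\<lbrakk>r x < r y; exec c1 (r, m, out) t s\<rbrakk>
    \<Longrightarrow> exec (If_Less x y c1 c2) (r, m, out) (1 + t) s"
| If_False: "\<lbrakk>\<not> r x < r y; exec c2 (r, m, out) t s\<rbrakk>
    \<Longrightarrow> exec (If_Less x y c1 c2) (r, m, out) (1 + t) s"
| While_False: "\<not> r x < r y \<Longrightarrow> exec (While_Less x y c) (r, m, out) 1 (r, m, out)"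
| While_True: "\<lbrakk>r x < r y; exec c (r, m, out) t1 s1; exec (While_Less x y c) s1 t2 s2\<rbrakk>
    \<Longrightarrow> exec (While_Less x y c) (r, m, out) (1 + t1 + t2) s2"

text \<open>Inputs are graphs with vertex set \<open>{0,\<dots>,n-1}\<close>. Memory cell \<open>0\<close> holds \<open>n\<close>; the following
  \<open>n\<^sup>2\<close> cells hold the adjacency matrix, row by row. Everything else is initially \<open>0\<close>.\<close>

definition input_graph :: "nat graph \<Rightarrow> bool" where
  "input_graph G \<longleftrightarrow> simple_graph G \<and> verts G = {..<gorder G}"

definition encode_graph :: "nat graph \<Rightarrow> nat \<Rightarrow> nat" where
  "encode_graph G a =
     (let n = gorder G in
      if a = 0 then n
      else if a \<le> n * n \<and> {(a - 1) div n, (a - 1) mod n} \<in> edges G then 1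
      else 0)"

text \<open>A set of vertices is written to the output as its characteristic vector, that is, by \<open>n\<close>
  output steps.\<close>

definition encode_set :: "nat \<Rightarrow> nat set \<Rightarrow> nat list" where
  "encode_set n A = map (\<lambda>i. if i \<in> A then 1 else 0) [0..<n]"

definition computes_in :: "com \<Rightarrow> nat graph \<Rightarrow> nat \<Rightarrow> nat list \<Rightarrow> bool" where
  "computes_in P G t out \<longleftrightarrow> (\<exists>r m. exec P (\<lambda>_. 0, encode_graph G, []) t (r, m, out))"

text \<open>On input \<open>G\<close>, the program halts after \<open>t\<close> steps, having listed every locally minimal defensive
  alliance of \<open>G\<close> exactly once and nothing else.\<close>

definition enumerates_in :: "com \<Rightarrow> nat graph \<Rightarrow> nat \<Rightarrow> bool" where
  "enumerates_in P G t \<longleftrightarrow>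
     (\<exists>As. distinct As \<and> set As = loc_min_defensive_alliances G \<and>
           computes_in P G t (concat (map (encode_set (gorder G)) As)))"

definition O_star :: "(nat \<Rightarrow> real) \<Rightarrow> (nat \<Rightarrow> real) set" where
  "O_star f = (\<Union>p :: real poly. O(\<lambda>n. poly p (real n) * f n))"

end

theory Submission
  imports Defs "HOL-Library.Nat_Bijection"
begin

text \<open>The algorithm runs a binary counter through all subsets of the vertex set and tests each subset
  \<open>A\<close>, together with all \<open>A - {v}\<close>, by counting neighbours.

  For the lower bound take \<open>K\<^bsub>2,2k\<^esub>\<close>. One vertex of the small side together with exactly \<open>k\<close> vertices
  of the large side is a locally minimal defensive alliance: without its centre, the remaining vertices
  have no neighbour inside, and without one of the \<open>k\<close> others, the centre is outnumbered. There are at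
  least \<open>(2k choose k)\<close> such sets. The lower bounds on pathwidth, treewidth and treedepth
  use only a four-cycle.\<close>

section \<open>Time-bounded weakest preconditions\<close>

text \<open>The machine can only add and subtract 1, which dictates the shape of the program. No
  address is computed by multiplication: pointers move one cell at a time through the adjacency
  matrix, and even \<open>n * n\<close> is obtained by counting. A deletion \<open>A - {v}\<close>
  is tested in place, by clearing one cell and restoring it afterwards. Each of the at most
  \<open>n + 1\<close> tests per subset scans the whole matrix, hence cubic work per subset.

  The graphs for the lower bound are forced as follows. In a star, a leaf without its centre has one
  neighbour outside, which the \<open>+ 1\<close> in the definition tolerates, so the centre could
  be deleted; two vertices on the small side are the fewest that prevent this. For a centre of
  degree \<open>2k\<close>, the least \<open>j\<close> with \<open>j + 1 >= 2k - j\<close> is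
  \<open>j = k\<close>, which is just where the binomial coefficient is largest. The two vertices of
  the small side cost a factor 4 against \<open>2 ^ n\<close>, and the central binomial coefficient
  costs a linear factor.\<close>

definition wp :: "com \<Rightarrow> nat \<Rightarrow> (state \<Rightarrow> bool) \<Rightarrow> state \<Rightarrow> bool" where
  "wp c B Q s \<longleftrightarrow> (\<exists>t s'. exec c s t s' \<and> t \<le> B \<and> Q s')"

lemma wp_mono: "wp c B Q s \<Longrightarrow> B \<le> B' \<Longrightarrow> (\<And>s. Q s \<Longrightarrow> Q' s) \<Longrightarrow> wp c B' Q' s"
  unfolding wp_def by (meson order_trans)

lemma wp_Seq:
  assumes "wp c1 B1 (wp c2 B2 Q) s" "B1 + B2 \<le> B"
  shows "wp (Seq c1 c2) B Q s"
proof -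
  obtain t1 s1 t2 s2 where "exec c1 s t1 s1" "t1 \<le> B1" "exec c2 s1 t2 s2" "t2 \<le> B2" "Q s2"
    using assms(1) unfolding wp_def by blast
  then show ?thesis
    using assms(2) exec.Seq[of c1 s t1 s1 c2 t2 s2] unfolding wp_def by (meson add_mono order_trans)
qed

primrec loopfree :: "com \<Rightarrow> bool" where
  "loopfree (Const x k) = True"
| "loopfree (Copy x y) = True"
| "loopfree (Incr x) = True"
| "loopfree (Decr x) = True"
| "loopfree (Load x y) = True"
| "loopfree (Store x y) = True"
| "loopfree (Output x) = True"
| "loopfree (Seq c1 c2) = (loopfree c1 \<and> loopfree c2)"
| "loopfree (If_Less x y c1 c2) = (loopfree c1 \<and> loopfree c2)"
| "loopfree (While_Less x y c) = False"

text \<open>\<open>run\<close> and \<open>cost\<close> are meaningful for loop-free programs only.\<close>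

fun run :: "com \<Rightarrow> state \<Rightarrow> state" where
  "run (Const x k) (r, m, out) = (r(x := k), m, out)"
| "run (Copy x y) (r, m, out) = (r(x := r y), m, out)"
| "run (Incr x) (r, m, out) = (r(x := r x + 1), m, out)"
| "run (Decr x) (r, m, out) = (r(x := r x - 1), m, out)"
| "run (Load x y) (r, m, out) = (r(x := m (r y)), m, out)"
| "run (Store x y) (r, m, out) = (r, m(r x := r y), out)"
| "run (Output x) (r, m, out) = (r, m, out @ [r x])"
| "run (Seq c1 c2) s = run c2 (run c1 s)"
| "run (If_Less x y c1 c2) (r, m, out) =
     (if r x < r y then run c1 (r, m, out) else run c2 (r, m, out))"
| "run (While_Less x y c) s = s"

primrec cost :: "com \<Rightarrow> nat" where
  "cost (Const x k) = 1"
| "cost (Copy x y) = 1"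
| "cost (Incr x) = 1"
| "cost (Decr x) = 1"
| "cost (Load x y) = 1"
| "cost (Store x y) = 1"
| "cost (Output x) = 1"
| "cost (Seq c1 c2) = cost c1 + cost c2"
| "cost (If_Less x y c1 c2) = 1 + max (cost c1) (cost c2)"
| "cost (While_Less x y c) = 0"

lemma exec_run: "loopfree c \<Longrightarrow> \<exists>t\<le>cost c. exec c s t (run c s)"
proof (induction c s rule: run.induct)
  case (8 c1 c2 s)
  then obtain t1 t2 where "t1 \<le> cost c1" "exec c1 s t1 (run c1 s)"
    "t2 \<le> cost c2" "exec c2 (run c1 s) t2 (run c2 (run c1 s))" by auto
  then show ?case by (auto intro!: exI[of _ "t1 + t2"] exec.Seq)
next
  case (9 x y c1 c2 r m out)
  show ?case
  proof (cases "r x < r y")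
    case True
    then obtain t where "t \<le> cost c1" "exec c1 (r, m, out) t (run c1 (r, m, out))"
      using 9 by auto
    with True show ?thesis by (auto intro!: exI[of _ "1 + t"] exec.If_True[of r x y, simplified])
  next
    case False
    then obtain t where "t \<le> cost c2" "exec c2 (r, m, out) t (run c2 (r, m, out))"
      using 9 by auto
    with False show ?thesis by (auto intro!: exI[of _ "1 + t"] exec.If_False[of r x y, simplified])
  qed
qed (auto intro: exec.intros[simplified])

text \<open>Reduces a loop-free block to evaluating \<open>run\<close> by simplification, with a
  computed constant as its time bound. Only loops then need invariants.\<close>

lemma wp_run: "loopfree c \<Longrightarrow> cost c \<le> B \<Longrightarrow> Q (run c s) \<Longrightarrow> wp c B Q s"
  unfolding wp_def using exec_run order_trans by blast

text \<open>The invariant is indexed by the number of completed rounds, so it also proves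
  termination: the guard holds below \<open>K\<close> and fails at \<open>K\<close>. Induction runs
  downwards from \<open>K\<close>; each round pays for one test and the body, and the final failing
  test is the extra 1.\<close>

lemma wp_While:
  assumes "I j s" "j \<le> K"
    and "\<And>k r m out. k < K \<Longrightarrow> I k (r, m, out) \<Longrightarrow> r x < r y \<and> wp c B (I (Suc k)) (r, m, out)"
    and "\<And>r m out. I K (r, m, out) \<Longrightarrow> \<not> r x < r y \<and> Q (r, m, out)"
  shows "wp (While_Less x y c) (1 + (K - j) * (B + 1)) Q s"
  using assms(2,1)
proof (induction j arbitrary: s rule: inc_induct)
  case base
  obtain r m out where s: "s = (r, m, out)" by (cases s)
  show ?case unfolding s wp_def using assms(4) base
    by (intro exI[of _ 1] exI[of _ "(r, m, out)"]) (auto simp: s intro!: exec.While_False[simplified])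
next
  case (step j)
  obtain r m out where s: "s = (r, m, out)" by (cases s)
  have xy: "r x < r y" and "wp c B (I (Suc j)) (r, m, out)"
    using assms(3)[of j r m out] step s by auto
  then obtain t1 s1 where t1: "exec c (r, m, out) t1 s1" "t1 \<le> B" "I (Suc j) s1"
    unfolding wp_def by blast
  obtain t2 s2 where t2: "exec (While_Less x y c) s1 t2 s2" "t2 \<le> 1 + (K - Suc j) * (B + 1)" "Q s2"
    using step.IH[OF t1(3)] unfolding wp_def by blast
  have "K - j = Suc (K - Suc j)" using step.hyps by simp
  then have "1 + t1 + t2 \<le> 1 + (K - j) * (B + 1)" using t1(2) t2(2) by simp
  then show ?case using exec.While_True[OF xy t1(1) t2(1)] t2(3) unfolding wp_def s by blast
qed

lemma wp_Seq':
  assumes "wp c1 B1 P s" "\<And>r m out. P (r, m, out) \<Longrightarrow> wp c2 B2 Q (r, m, out)" "B1 + B2 \<le> B"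
  shows "wp (Seq c1 c2) B Q s"
  using assms by (auto intro!: wp_Seq wp_mono[OF assms(1)])

lemma wp_run_Seq:
  assumes "loopfree c1" "cost c1 \<le> B" "wp c2 (B - cost c1) Q (run c1 s)"
  shows "wp (Seq c1 c2) B Q s"
  by (rule wp_Seq, rule wp_run[OF assms(1) order_refl], rule assms(3)) (use assms(2) in simp)

section \<open>Register layout and counting loops\<close>

abbreviation seq_syntax (infixr \<open>;;\<close> 60) where "c1 ;; c2 \<equiv> Seq c1 c2"

text \<open>The numbering makes the scratch registers of nested blocks intervals: 3 to 13 for
  testing a set, 3 to 17 for testing local minimality. Registers 0, 1, 2 and 19 stay constant after
  the setup.\<close>

abbreviation (input) "rZero \<equiv> 0 :: reg"
abbreviation (input) "rN \<equiv> 1 :: reg"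
abbreviation (input) "rBase \<equiv> 2 :: reg"
abbreviation (input) "rRow \<equiv> 3 :: reg"
abbreviation (input) "rV \<equiv> 4 :: reg"
abbreviation (input) "rVP \<equiv> 5 :: reg"
abbreviation (input) "rU \<equiv> 6 :: reg"
abbreviation (input) "rUP \<equiv> 7 :: reg"
abbreviation (input) "rIn \<equiv> 8 :: reg"
abbreviation (input) "rOut \<equiv> 9 :: reg"
abbreviation (input) "rA \<equiv> 10 :: reg"
abbreviation (input) "rB \<equiv> 11 :: reg"
abbreviation (input) "rOk \<equiv> 12 :: reg"
abbreviation (input) "rBad \<equiv> 13 :: reg"
abbreviation (input) "rMin \<equiv> 14 :: reg"
abbreviation (input) "rW \<equiv> 15 :: reg"
abbreviation (input) "rWP \<equiv> 16 :: reg"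
abbreviation (input) "rBit \<equiv> 17 :: reg"
abbreviation (input) "rCarry \<equiv> 18 :: reg"
abbreviation (input) "rOne \<equiv> 19 :: reg"

abbreviation (input) "skip \<equiv> Copy rZero rZero"

definition For :: "reg \<Rightarrow> com \<Rightarrow> com" where
  "For i c = Const i 0 ;; While_Less i rN (c ;; Incr i)"

text \<open>The initialisation and the last, failing test account for the 2; each round adds its own
  test and its \<open>Incr\<close> to the cost of the body. The invariant is meant after the
  \<open>Incr\<close>, which is why the postcondition of the body updates
  \<open>r i\<close>.\<close>

lemma wp_For:
  assumes "I 0 (r(i := 0), m, out)"
    and "\<And>k r m out. k < n \<Longrightarrow> I k (r, m, out) \<Longrightarrow>
       wp c B (\<lambda>(r, m, out). I (Suc k) (r(i := Suc (r i)), m, out)) (r, m, out)"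
    and "\<And>k r m out. I k (r, m, out) \<Longrightarrow> r i = k \<and> r rN = n"
    and "\<And>r m out. I n (r, m, out) \<Longrightarrow> Q (r, m, out)"
    and "2 + n * (B + 2) \<le> T"
  shows "wp (For i c) T Q (r, m, out)"
proof -
  have "wp (While_Less i rN (c ;; Incr i)) (1 + (n - 0) * ((B + 1) + 1)) Q (r(i := 0), m, out)"
  proof (rule wp_While[where I = I and j = 0 and K = n])
    fix k r m out assume k: "k < n" "I k (r, m, out)"
    have "wp c B (wp (Incr i) 1 (I (Suc k))) (r, m, out)"
      using assms(2)[OF k] by (rule wp_mono) (auto intro!: wp_run)
    then show "r i < r rN \<and> wp (c ;; Incr i) (B + 1) (I (Suc k)) (r, m, out)"
      using assms(3)[OF k(2)] k(1) by (auto intro: wp_Seq)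
  next
    fix r m out assume "I n (r, m, out)"
    then show "\<not> r i < r rN \<and> Q (r, m, out)" using assms(3,4) by fastforce
  qed (use assms(1) in auto)
  moreover have "1 + (1 + (n - 0) * ((B + 1) + 1)) \<le> T" using assms(5) by simp
  ultimately show ?thesis unfolding For_def by (intro wp_Seq[OF wp_run]) auto
qed

section \<open>Enumeration with a binary counter\<close>

text \<open>Frame condition: \<open>X\<close> collects the registers that a block may
  overwrite.\<close>

definition agree :: "reg set \<Rightarrow> (reg \<Rightarrow> nat) \<Rightarrow> (reg \<Rightarrow> nat) \<Rightarrow> bool" where
  "agree X r r' \<longleftrightarrow> (\<forall>x. x \<notin> X \<longrightarrow> r' x = r x)"

text \<open>Memory layout: the input stays in place, and the current set is a bit vector in the
  \<open>n\<close> cells behind the matrix. Elements of \<open>A\<close> that are at least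
  \<open>n\<close> are invisible to this predicate.\<close>

definition holds :: "nat graph \<Rightarrow> nat set \<Rightarrow> (nat \<Rightarrow> nat) \<Rightarrow> bool" where
  "holds G A m \<longleftrightarrow>
     (\<forall>a\<le>gorder G * gorder G. m a = encode_graph G a) \<and>
     (\<forall>i<gorder G. m (gorder G * gorder G + 1 + i) = of_bool (i \<in> A))"

lemma matrix_address:
  assumes "v < n" "u < n" shows "(v * n + u :: nat) < n * n"
proof -
  have "v * n + u < Suc v * n" using assms by simp
  also have "\<dots> \<le> n * n" using assms by (intro mult_le_mono1) simp
  finally show ?thesis .
qed

lemma holds_adjacent:
  assumes "holds G A m" "v < gorder G" "u < gorder G"
  shows "m (Suc (v * gorder G + u)) = of_bool ({u, v} \<in> edges G)"
  using assms matrix_address[of v "gorder G" u]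
  by (auto simp: holds_def encode_graph_def Let_def insert_commute)

lemma holds_member:
  assumes "holds G A m" "i < gorder G"
  shows "m (Suc (gorder G * gorder G + i)) = of_bool (i \<in> A)"
  using assms by (auto simp: holds_def)

lemma card_less_Suc:
  "card {u. u < Suc k \<and> P u} = card {u. u < k \<and> P u} + of_bool (P k)"
proof -
  have "{u. u < Suc k \<and> P u} = {u. u < k \<and> P u} \<union> (if P k then {k} else {})"
    by (auto simp: less_Suc_eq)
  then show ?thesis by (auto simp: card_insert_if)
qed

text \<open>\<open>rIn\<close> starts at 1 to account for the \<open>+ 1\<close> in the alliance
  condition. \<open>rRow\<close> is not reset: after a full scan it points to the start of the next
  row, so that successive calls walk through the matrix.\<close>

definition count_com :: com where
  "count_com = Const rIn 1 ;; Const rOut 0 ;; Copy rUP rBase ;;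
     For rU (Load rA rRow ;; Load rB rUP ;;
       If_Less rZero rA (If_Less rZero rB (Incr rIn) (Incr rOut)) skip ;;
       Incr rRow ;; Incr rUP)"

lemma wp_count:
  assumes m: "holds G A m" and n: "gorder G = n" and v: "v < n"
    and r: "r rZero = 0" "r rN = n" "r rBase = Suc (n * n)" "r rRow = Suc (v * n)"
  shows "wp count_com (5 + n * 10)
    (\<lambda>(r', m', out'). m' = m \<and> out' = out \<and> agree {rRow, rU, rUP, rIn, rOut, rA, rB} r r' \<and>
       r' rRow = Suc (Suc v * n) \<and>
       r' rIn = card {u. u < n \<and> {u, v} \<in> edges G \<and> u \<in> A} + 1 \<and>
       r' rOut = card {u. u < n \<and> {u, v} \<in> edges G \<and> u \<notin> A}) (r, m, out)"
    (is "wp _ _ ?Q _")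
proof -
  let ?I = "\<lambda>k (r', m', out'). m' = m \<and> out' = out \<and>
       agree {rRow, rU, rUP, rIn, rOut, rA, rB} r r' \<and>
       r' rU = k \<and> r' rRow = Suc (v * n + k) \<and> r' rUP = Suc (n * n + k) \<and>
       r' rIn = card {u. u < k \<and> {u, v} \<in> edges G \<and> u \<in> A} + 1 \<and>
       r' rOut = card {u. u < k \<and> {u, v} \<in> edges G \<and> u \<notin> A}"
  have "wp (For rU (Load rA rRow ;; Load rB rUP ;;
       If_Less rZero rA (If_Less rZero rB (Incr rIn) (Incr rOut)) skip ;;
       Incr rRow ;; Incr rUP)) (2 + n * 10) ?Q (r(rIn := 1, rOut := 0, rUP := Suc (n * n)), m, out)"
  proof (rule wp_For[where I = ?I and n = n and B = 8], goal_cases)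
    case 1
    then show ?case using r by (simp add: agree_def)
  next
    case (2 k r' m' out')
    then show ?case
      using r n v holds_adjacent[OF m, of v k] holds_member[OF m, of k]
      by (intro wp_run) (auto simp: agree_def card_less_Suc)
  next
    case (3 k r' m' out')
    then show ?case using r by (simp add: agree_def)
  qed auto
  then show ?thesis unfolding count_com_def by (simp add: wp_run_Seq r)
qed

section \<open>Testing a set and its one-vertex deletions\<close>

text \<open>The empty set is vacuously a defensive alliance, so non-emptiness needs its own flag:
  \<open>rOk\<close> is raised by the first member found. \<open>rBad\<close> records an outnumbered
  member and overrides \<open>rOk\<close> at the end.\<close>

definition check_com :: com where
  "check_com = Const rOk 0 ;; Const rBad 0 ;; Const rRow 1 ;; Copy rVP rBase ;;
     For rV (count_com ;; Load rB rVP ;;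
       If_Less rZero rB (Const rOk 1 ;; If_Less rIn rOut (Const rBad 1) skip) skip ;;
       Incr rVP) ;;
     If_Less rZero rBad (Const rOk 0) skip"

lemma wp_check:
  assumes G: "input_graph G" and m: "holds G A m" and n: "gorder G = n" and A: "A \<subseteq> {..<n}"
    and r: "r rZero = 0" "r rN = n" "r rBase = Suc (n * n)"
  shows "wp check_com (8 + n * (13 + n * 10))
    (\<lambda>(r', m', out'). m' = m \<and> out' = out \<and> agree {3..13} r r' \<and>
       r' rOk = of_bool (A \<noteq> {} \<and> defensive_alliance G A)) (r, m, out)"
proof -
  let ?in = "\<lambda>v. card {u. u < n \<and> {u, v} \<in> edges G \<and> u \<in> A}"
  let ?out = "\<lambda>v. card {u. u < n \<and> {u, v} \<in> edges G \<and> u \<notin> A}"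
  let ?bad = "\<lambda>k. \<exists>v<k. v \<in> A \<and> ?in v + 1 < ?out v"
  let ?I = "\<lambda>k (r', m', out'). m' = m \<and> out' = out \<and> agree {3..13} r r' \<and>
       r' rV = k \<and> r' rRow = Suc (k * n) \<and> r' rVP = Suc (n * n + k) \<and>
       r' rOk = of_bool (\<exists>v<k. v \<in> A) \<and> r' rBad = of_bool (?bad k)"
  let ?body = "Load rB rVP ;;
       If_Less rZero rB (Const rOk 1 ;; If_Less rIn rOut (Const rBad 1) skip) skip ;; Incr rVP"
  have loop: "wp (For rV (count_com ;; ?body)) (2 + n * ((11 + n * 10) + 2)) (?I n)
      (r(rOk := 0, rBad := 0, rRow := 1, rVP := Suc (n * n)), m, out)"
  proof (rule wp_For[where I = ?I and n = n and B = "11 + n * 10"], goal_cases)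
    case 1
    then show ?case using r by (simp add: agree_def)
  next
    case (2 k r' m' out')
    then have m': "m' = m" and out': "out' = out" and r': "agree {3..13} r r'"
      "r' rV = k" "r' rRow = Suc (k * n)" "r' rVP = Suc (n * n + k)"
       "r' rOk = of_bool (\<exists>v<k. v \<in> A)" "r' rBad = of_bool (?bad k)"
      by auto
    have *: "r' rZero = 0" "r' rN = n" "r' rBase = Suc (n * n)"
      using r' r by (simp_all add: agree_def)
    show ?case unfolding m' out'
    proof (rule wp_Seq'[OF wp_count[OF m n \<open>k < n\<close> * r'(3)], where ?B2.0 = 6], goal_cases)
      case (1 r2 m2 out2)
      then have r2: "m2 = m" "out2 = out" "agree {3..13} r r2" "r2 rZero = 0"
        "r2 rV = k" "r2 rRow = Suc (Suc k * n)" "r2 rVP = Suc (n * n + k)"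
        "r2 rIn = ?in k + 1" "r2 rOut = ?out k"
        "r2 rOk = of_bool (\<exists>v<k. v \<in> A)" "r2 rBad = of_bool (?bad k)"
        using r' * by (auto simp: agree_def)
      show ?case
        by (rule wp_run)
          (use r2 holds_member[OF m, of k] n \<open>k < n\<close> in
            \<open>simp_all add: Ex_less_Suc agree_def\<close>)
    qed simp
  next
    case (3 k r' m' out')
    then show ?case using r by (simp add: agree_def)
  qed auto
  have "wp (For rV (count_com ;; ?body) ;; If_Less rZero rBad (Const rOk 0) skip)
    (4 + n * (13 + n * 10))
    (\<lambda>(r', m', out'). m' = m \<and> out' = out \<and> agree {3..13} r r' \<and>
       r' rOk = of_bool ((\<exists>v<n. v \<in> A) \<and> \<not> ?bad n))
      (r(rOk := 0, rBad := 0, rRow := 1, rVP := Suc (n * n)), m, out)"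
  proof (rule wp_Seq'[OF loop, where ?B2.0 = 2], goal_cases)
    case (1 r2 m2 out2)
    then have r2: "m2 = m" "out2 = out" "agree {3..13} r r2" "r2 rZero = 0"
      "r2 rOk = of_bool (\<exists>v<n. v \<in> A)" "r2 rBad = of_bool (?bad n)"
      using r by (auto simp: agree_def)
    then show ?case by (intro wp_run) (auto simp: agree_def)
  qed simp
  moreover have "(\<exists>v<n. v \<in> A) \<and> \<not> ?bad n \<longleftrightarrow> A \<noteq> {} \<and> defensive_alliance G A"
  proof -
    have V: "verts G = {..<n}" using G n by (simp add: input_graph_def)
    have "{u. u < n \<and> {u, v} \<in> edges G \<and> u \<in> A} = nbh G v \<inter> A"
      "{u. u < n \<and> {u, v} \<in> edges G \<and> u \<notin> A} = nbh G v \<inter> (verts G - A)" for v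
      using V by (auto simp: nbh_def)
    moreover have "(\<exists>v<n. v \<in> A \<and> P v) \<longleftrightarrow> (\<exists>v\<in>A. P v)" "(\<exists>v<n. v \<in> A) \<longleftrightarrow> A \<noteq> {}" for P
      using A by auto
    ultimately show ?thesis using A V
      by (simp add: defensive_alliance_def deg_in_def not_less)
  qed
  ultimately show ?thesis unfolding check_com_def by (simp add: wp_run_Seq r)
qed

lemma holds_insert:
  assumes "holds G A m" "i < gorder G"
  shows "holds G (insert i A) (m(Suc (gorder G * gorder G + i) := 1))"
  using assms by (auto simp: holds_def)

lemma holds_remove:
  assumes "holds G A m" "i < gorder G"
  shows "holds G (A - {i}) (m(Suc (gorder G * gorder G + i) := 0))"
  using assms by (auto simp: holds_def)

text \<open>\<open>rBit\<close> has two uses. Writing it back restores the memory exactly, and its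
  test guards the verdict: for \<open>v\<close> outside \<open>A\<close> the tested set is
  \<open>A\<close> itself, whose success must not count against minimality.\<close>

definition minimal_com :: com where
  "minimal_com = check_com ;; Copy rMin rOk ;; Copy rWP rBase ;;
     For rW ((Load rBit rWP ;; Store rWP rZero) ;; check_com ;; Store rWP rBit ;;
       If_Less rZero rBit (If_Less rZero rOk (Const rMin 0) skip) skip ;; Incr rWP)"

abbreviation check_bound :: "nat \<Rightarrow> nat" where
  "check_bound n \<equiv> 8 + n * (13 + n * 10)"

lemma wp_minimal:
  assumes G: "input_graph G" and m: "holds G A m" and n: "gorder G = n" and A: "A \<subseteq> {..<n}"
    and r: "r rZero = 0" "r rN = n" "r rBase = Suc (n * n)"
  shows "wp minimal_com (check_bound n + 4 + n * (check_bound n + 9))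
    (\<lambda>(r', m', out'). m' = m \<and> out' = out \<and> agree {3..17} r r' \<and>
       r' rMin = of_bool (loc_min_defensive_alliance G A)) (r, m, out)"
proof -
  define ok where "ok B \<longleftrightarrow> B \<noteq> {} \<and> defensive_alliance G B" for B
  let ?I = "\<lambda>k (r', m', out'). m' = m \<and> out' = out \<and> agree {3..17} r r' \<and>
       r' rW = k \<and> r' rWP = Suc (n * n + k) \<and>
       r' rMin = of_bool (ok A \<and> \<not> (\<exists>v<k. v \<in> A \<and> ok (A - {v})))"
  let ?suffix = "Store rWP rBit ;;
       If_Less rZero rBit (If_Less rZero rOk (Const rMin 0) skip) skip ;; Incr rWP"
  let ?loop = "For rW ((Load rBit rWP ;; Store rWP rZero) ;; check_com ;; ?suffix)"
  have loop: "wp ?loop (2 + n * (check_bound n + 9)) (?I n) (r', m, out)"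
    if r': "agree {3..17} r r'" "r' rMin = of_bool (ok A)" "r' rWP = Suc (n * n)" for r'
  proof (rule wp_For[where I = ?I and n = n and B = "check_bound n + 7"], goal_cases)
    case 1
    then show ?case using r' by (simp add: agree_def)
  next
    case (2 k r' m' out')
    then have m': "m' = m" and out': "out' = out" and r': "agree {3..17} r r'"
      "r' rW = k" "r' rWP = Suc (n * n + k)"
      "r' rMin = of_bool (ok A \<and> \<not> (\<exists>v<k. v \<in> A \<and> ok (A - {v})))"
      by auto
    let ?a = "Suc (n * n + k)"
    let ?r = "r'(rBit := m ?a)"
    have *: "?r rZero = 0" "?r rN = n" "?r rBase = Suc (n * n)"
      using r' r by (simp_all add: agree_def)
    have ma: "0 < m ?a \<longleftrightarrow> k \<in> A" using holds_member[OF m, of k] \<open>k < n\<close> n by simp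
    have m2: "holds G (A - {k}) (m(?a := 0))" using holds_remove[OF m, of k] \<open>k < n\<close> n by simp
    have A2: "A - {k} \<subseteq> {..<n}" using A by auto
    have "wp (check_com ;; ?suffix) (check_bound n + 5)
        (\<lambda>(r, m, out). ?I (Suc k) (r(rW := Suc (r rW)), m, out)) (?r, m(?a := 0), out)"
    proof (rule wp_Seq'[OF wp_check[OF G m2 n A2 *], where ?B2.0 = 5], goal_cases)
      case (1 r2 m3 out3)
      then have r2: "m3 = m(?a := 0)" "out3 = out" "agree {3..17} r r2" "r2 rZero = 0"
        "r2 rW = k" "r2 rWP = ?a" "r2 rBit = m ?a" "r2 rOk = of_bool (ok (A - {k}))"
        "r2 rMin = of_bool (ok A \<and> \<not> (\<exists>v<k. v \<in> A \<and> ok (A - {v})))"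
        using r' * by (auto simp: agree_def ok_def)
      then show ?case by (intro wp_run) (auto simp: agree_def Ex_less_Suc ma)
    qed simp
    then show ?case unfolding m' out'
      using r' * by (intro wp_run_Seq[of "Load rBit rWP ;; Store rWP rZero"]) simp_all
  next
    case (3 k r' m' out')
    then show ?case using r by (simp add: agree_def)
  qed auto
  have lm: "ok A \<and> \<not> (\<exists>v<n. v \<in> A \<and> ok (A - {v})) \<longleftrightarrow> loc_min_defensive_alliance G A"
    using A by (auto simp: ok_def loc_min_defensive_alliance_def)
  show ?thesis unfolding minimal_com_def
  proof (rule wp_Seq'[OF wp_check[OF G m n A r], where ?B2.0 = "4 + n * (check_bound n + 9)"], goal_cases)
    case (1 r2 m2 out2)
    then have m2: "m2 = m" "out2 = out"
      and r2: "agree {3..17} r r2" "r2 rOk = of_bool (ok A)" "r2 rBase = Suc (n * n)"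
      using r by (auto simp: agree_def ok_def)
    have "wp ?loop (2 + n * (check_bound n + 9)) (?I n)
        (r2(rMin := r2 rOk, rWP := r2 rBase), m, out)"
      by (rule loop) (use r2 in \<open>auto simp: agree_def\<close>)
    then have "wp ?loop (2 + n * (check_bound n + 9)) (\<lambda>(r', m', out'). m' = m \<and> out' = out \<and> agree {3..17} r r' \<and>
       r' rMin = of_bool (loc_min_defensive_alliance G A))
        (r2(rMin := r2 rOk, rWP := r2 rBase), m, out)"
      by (rule wp_mono) (auto simp: lm[symmetric])
    then show ?case using m2 by (simp add: wp_run_Seq)
  qed simp
qed

definition output_com :: com where
  "output_com = Copy rWP rBase ;;
     For rW (Load rBit rWP ;; If_Less rZero rMin (Output rBit) skip ;; Incr rWP)"

lemma wp_output:
  assumes m: "holds G A m" and n: "gorder G = n"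
    and r: "r rZero = 0" "r rN = n" "r rBase = Suc (n * n)" "r rMin = of_bool b"
  shows "wp output_com (3 + n * 6)
    (\<lambda>(r', m', out'). m' = m \<and> agree {rW, rWP, rBit} r r' \<and>
       out' = out @ (if b then encode_set n A else [])) (r, m, out)"
proof -
  let ?I = "\<lambda>k (r', m', out'). m' = m \<and> agree {rW, rWP, rBit} r r' \<and>
       r' rW = k \<and> r' rWP = Suc (n * n + k) \<and>
       out' = out @ (if b then map (\<lambda>i. if i \<in> A then 1 else 0) [0..<k] else [])"
  have "wp (For rW (Load rBit rWP ;; If_Less rZero rMin (Output rBit) skip ;; Incr rWP)) (2 + n * 6)
    (\<lambda>(r', m', out'). m' = m \<and> agree {rW, rWP, rBit} r r' \<and>
       out' = out @ (if b then encode_set n A else [])) (r(rWP := Suc (n * n)), m, out)"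
  proof (rule wp_For[where I = ?I and n = n and B = 4], goal_cases)
    case 1
    then show ?case by (simp add: agree_def)
  next
    case (2 k r' m' out')
    then have r': "m' = m" "agree {rW, rWP, rBit} r r'" "r' rW = k" "r' rWP = Suc (n * n + k)"
       "out' = out @ (if b then map (\<lambda>i. if i \<in> A then 1 else 0) [0..<k] else [])"
       "r' rZero = 0" "r' rMin = of_bool b"
      using r by (auto simp: agree_def)
    then show ?case using holds_member[OF m, of k] \<open>k < n\<close> n
      by (intro wp_run) (auto simp: agree_def)
  next
    case (3 k r' m' out')
    then show ?case using r by (simp add: agree_def)
  qed (auto simp: encode_set_def)
  then show ?thesis unfolding output_com_def by (simp add: wp_run_Seq r)
qed

section \<open>Binary increment\<close>

text \<open>The quotient by \<open>2 ^ j\<close> grows by one, and hence changes parity, exactly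
  when \<open>2 ^ j\<close> divides \<open>Suc k\<close>; otherwise it stays the same. The
  divisibility says that the carry reaches position \<open>j\<close>.\<close>

lemma set_decode_Suc:
  "j \<in> set_decode (Suc k) \<longleftrightarrow> (if 2 ^ j dvd Suc k then j \<notin> set_decode k else j \<in> set_decode k)"
  by (simp add: set_decode_def div_Suc flip: dvd_eq_mod_eq_0)

text \<open>Update rule of the carry: it leaves position \<open>j\<close> iff it arrives there and
  finds a set bit.\<close>

lemma power_Suc_dvd_Suc:
  "2 ^ Suc j dvd Suc k \<longleftrightarrow> 2 ^ j dvd Suc k \<and> j \<in> set_decode k"
proof (cases "2 ^ j dvd Suc k")
  case True
  then obtain q where q: "Suc k = 2 ^ j * q" by (elim dvdE)
  have "j \<in> set_decode (Suc k) \<longleftrightarrow> odd q" by (simp add: set_decode_def q)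
  moreover have "2 ^ Suc j dvd Suc k \<longleftrightarrow> even q"
    unfolding q power_Suc2 by simp
  ultimately show ?thesis using True set_decode_Suc[of j k] by auto
next
  case False
  then show ?thesis by (metis dvd_mult_right power_Suc)
qed

definition next_com :: com where
  "next_com = Const rCarry 1 ;; Copy rWP rBase ;;
     For rW (If_Less rZero rCarry
         (Load rBit rWP ;;
          If_Less rZero rBit (Store rWP rZero) (Store rWP rOne ;; Const rCarry 0))
         skip ;;
       Incr rWP)"

lemma wp_next:
  assumes m: "holds G (set_decode k) m" and n: "gorder G = n"
    and r: "r rZero = 0" "r rN = n" "r rBase = Suc (n * n)" "r rOne = 1"
  shows "wp next_com (4 + n * 8)
    (\<lambda>(r', m', out'). holds G (set_decode (Suc k)) m' \<and> agree {rW, rWP, rBit, rCarry} r r' \<and>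
       r' rCarry = of_bool (2 ^ n dvd Suc k) \<and> out' = out) (r, m, out)"
proof -
  \<comment> \<open>A hybrid of the two counter values: positions below \<open>j\<close> are already
    those of \<open>Suc k\<close>, the others still those of \<open>k\<close>.\<close>
  define B where "B j = {i. i \<in> set_decode (if i < j then Suc k else k)}" for j
  let ?I = "\<lambda>j (r', m', out'). holds G (B j) m' \<and> agree {rW, rWP, rBit, rCarry} r r' \<and>
       r' rW = j \<and> r' rWP = Suc (n * n + j) \<and>
       r' rCarry = of_bool (2 ^ j dvd Suc k) \<and> out' = out"
  have "wp (For rW (If_Less rZero rCarry
         (Load rBit rWP ;;
          If_Less rZero rBit (Store rWP rZero) (Store rWP rOne ;; Const rCarry 0))
         skip ;;
       Incr rWP)) (2 + n * 8)
    (\<lambda>(r', m', out'). holds G (set_decode (Suc k)) m' \<and> agree {rW, rWP, rBit, rCarry} r r' \<and>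
       r' rCarry = of_bool (2 ^ n dvd Suc k) \<and> out' = out)
    (r(rCarry := 1, rWP := Suc (n * n)), m, out)"
  proof (rule wp_For[where I = ?I and n = n and B = 6], goal_cases)
    case 1
    have "B 0 = set_decode k" by (simp add: B_def)
    then show ?case using m by (simp add: agree_def)
  next
    case (2 j r' m' out')
    then have r': "holds G (B j) m'" "agree {rW, rWP, rBit, rCarry} r r'"
       "r' rW = j" "r' rWP = Suc (n * n + j)" "r' rCarry = of_bool (2 ^ j dvd Suc k)" "out' = out"
       "r' rZero = 0" "r' rOne = 1"
      using r by (auto simp: agree_def)
    have mem: "m' (Suc (n * n + j)) = of_bool (j \<in> set_decode k)"
      using holds_member[OF r'(1), of j] \<open>j < n\<close> n by (simp add: B_def)
    have B: "B (Suc j) = (if j \<in> set_decode (Suc k) then insert j (B j) else B j - {j})"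
      by (auto simp: B_def less_Suc_eq split: if_splits)
    consider "\<not> 2 ^ j dvd Suc k" | "2 ^ j dvd Suc k" "j \<in> set_decode k"
      | "2 ^ j dvd Suc k" "j \<notin> set_decode k" by blast
    then show ?case
    proof cases
      case 1
      then have "B (Suc j) = B j"
        using set_decode_Suc[of j k] unfolding B by (auto simp: B_def)
      moreover have "\<not> 2 ^ Suc j dvd Suc k" using 1 power_Suc_dvd_Suc by blast
      ultimately show ?thesis using 1 r' by (intro wp_run) (simp_all add: agree_def del: power_Suc)
    next
      case 2
      then have "B (Suc j) = B j - {j}" using set_decode_Suc[of j k] unfolding B by simp
      moreover have "2 ^ Suc j dvd Suc k" using 2 power_Suc_dvd_Suc by blast
      ultimately show ?thesis using 2 r' mem holds_remove[OF r'(1), of j] \<open>j < n\<close> n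
        by (intro wp_run) (simp_all add: agree_def del: power_Suc)
    next
      case 3
      then have "B (Suc j) = insert j (B j)" using set_decode_Suc[of j k] unfolding B by simp
      moreover have "\<not> 2 ^ Suc j dvd Suc k" using 3 power_Suc_dvd_Suc by blast
      ultimately show ?thesis using 3 r' mem holds_insert[OF r'(1), of j] \<open>j < n\<close> n
        by (intro wp_run) (simp_all add: agree_def del: power_Suc)
    qed
  next
    case (3 k r' m' out')
    then show ?case using r by (simp add: agree_def)
  next
    case (4 r' m' out')
    \<comment> \<open>\<open>B n\<close> and \<open>set_decode (Suc k)\<close> may differ at
      positions from \<open>n\<close> on, but \<open>holds\<close> inspects only those below
      \<open>n\<close>. On overflow, \<open>Suc k = 2 ^ n\<close> thus appears as the empty
      set.\<close>
    then show ?case by (auto simp: holds_def B_def n)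
  qed auto
  then show ?thesis unfolding next_com_def by (simp add: wp_run_Seq r)
qed

section \<open>Initialisation, main loop and total running time\<close>

definition setup_com :: com where
  "setup_com = Load rN rZero ;; Const rOne 1 ;; Const rBase 1 ;; For rV (For rU (Incr rBase))"

lemma wp_setup:
  assumes "m 0 = n"
  shows "wp setup_com (5 + n * (4 + n * 3))
    (\<lambda>(r', m', out'). m' = m \<and> out' = out \<and> r' rZero = 0 \<and> r' rN = n \<and> r' rOne = 1 \<and>
       r' rBase = Suc (n * n) \<and> r' rCarry = 0) (\<lambda>_. 0, m, out)"
proof -
  let ?P = "\<lambda>b (r', m', out'). m' = m \<and> out' = out \<and> r' rZero = 0 \<and> r' rN = n \<and> r' rOne = 1 \<and>
       r' rBase = Suc b \<and> r' rCarry = 0"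
  have inner: "wp (For rU (Incr rBase)) (2 + n * 3)
      (\<lambda>(r', m', out'). ?P (k * n + n) (r', m', out') \<and> r' rV = k) (r, m, out)"
    if "?P (k * n) (r, m, out)" "r rV = k" for k r
    by (rule wp_For[where n = n and B = 1 and
          I = "\<lambda>j (r', m', out'). ?P (k * n + j) (r', m', out') \<and> r' rU = j \<and> r' rV = k"])
      (use that in \<open>auto intro!: wp_run\<close>)
  have "wp (For rV (For rU (Incr rBase))) (2 + n * (4 + n * 3)) (?P (n * n))
      ((\<lambda>_. 0)(rN := n, rOne := 1, rBase := 1), m, out)"
  proof (rule wp_For[where n = n and B = "2 + n * 3" and
          I = "\<lambda>k (r', m', out'). ?P (k * n) (r', m', out') \<and> r' rV = k"], goal_cases)
    case (2 k r' m' out')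
    then have "?P (k * n) (r', m, out)" "r' rV = k" "m' = m" "out' = out" by auto
    then show ?case using wp_mono[OF inner[of k r'] order_refl] by (auto simp: add.commute)
  qed (auto simp: algebra_simps)
  then show ?thesis unfolding setup_com_def by (simp add: wp_run_Seq assms)
qed

definition enumerate_com :: com where
  "enumerate_com = setup_com ;;
     While_Less rCarry rOne (minimal_com ;; output_com ;; next_com)"

definition body_bound :: "nat \<Rightarrow> nat" where
  "body_bound n = (check_bound n + 4 + n * (check_bound n + 9)) + ((3 + n * 6) + (4 + n * 8))"

definition total_bound :: "nat \<Rightarrow> nat" where
  "total_bound n = (5 + n * (4 + n * 3)) + (1 + 2 ^ n * (body_bound n + 1))"

lemma set_decode_subset: assumes "k < 2 ^ n" shows "set_decode k \<subseteq> {..<n}"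
proof
  fix i assume "i \<in> set_decode k"
  then have "2 ^ i \<le> k"
    by (metis set_decode_def mem_Collect_eq div_less even_zero not_le)
  then have "(2::nat) ^ i < 2 ^ n" using assms by (rule le_less_trans)
  then show "i \<in> {..<n}" by simp
qed

text \<open>Injectivity gives the image \<open>2 ^ n\<close> elements, as many as the power set that
  contains it, so no preimages have to be exhibited.\<close>

lemma set_decode_image: "set_decode ` {..<2 ^ n} = Pow {..<n}"
proof (rule card_subset_eq)
  show "set_decode ` {..<2 ^ n} \<subseteq> Pow {..<n}" using set_decode_subset by blast
  have "inj_on set_decode {..<2 ^ n}" by (metis inj_onI set_decode_inverse)
  then show "card (set_decode ` {..<2 ^ n}) = card (Pow {..<n})" by (simp add: card_image card_Pow)
qed simp

lemma enumerates_enumerate_com: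
  assumes G: "input_graph G"
  shows "\<exists>t\<le>total_bound (gorder G). enumerates_in enumerate_com G t"
proof -
  define n where "n = gorder G"
  note n = n_def[symmetric]
  define As where "As k = filter (loc_min_defensive_alliance G) (map set_decode [0..<k])" for k
  have As_Suc: "As (Suc k) = As k @
      (if loc_min_defensive_alliance G (set_decode k) then [set_decode k] else [])" for k
    by (simp add: As_def)
  let ?regs = "\<lambda>r. r rZero = 0 \<and> r rN = n \<and> r rOne = 1 \<and> r rBase = Suc (n * n)"
  let ?I = "\<lambda>k (r, m, out). ?regs r \<and> holds G (set_decode k) m \<and>
       r rCarry = of_bool (k = 2 ^ n) \<and> out = concat (map (encode_set n) (As k))"
  let ?m = "encode_graph G"
  have body: "wp (minimal_com ;; output_com ;; next_com) (body_bound n) (?I (Suc k)) (r, m, out)"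
    if k: "k < 2 ^ n" and I: "?I k (r, m, out)" for k r m out
  proof -
    have m: "holds G (set_decode k) m" and r: "?regs r"
      and out: "out = concat (map (encode_set n) (As k))" using I by auto
    \<comment> \<open>As \<open>Suc k\<close> is at most \<open>2 ^ n\<close>, the carry leaves the
      last position only after the last subset. This overflow is what ends the main loop.\<close>
    have carry: "2 ^ n dvd Suc k \<longleftrightarrow> Suc k = 2 ^ n" using k by (auto dest: dvd_imp_le)
    show ?thesis
    proof (rule wp_Seq'[OF wp_minimal[OF G m n set_decode_subset[OF k]],
          where ?B2.0 = "(3 + n * 6) + (4 + n * 8)"], goal_cases)
      case (4 r2 m2 out2)
      then have m2: "m2 = m" "out2 = out" and r2: "?regs r2"
        "r2 rMin = of_bool (loc_min_defensive_alliance G (set_decode k))"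
        using r by (auto simp: agree_def)
      show ?case unfolding m2
      proof (rule wp_Seq'[OF wp_output[OF m n, where b = "loc_min_defensive_alliance G (set_decode k)"],
          where ?B2.0 = "4 + n * 8"], goal_cases)
        case (5 r3 m3 out3)
        then have m3: "m3 = m" "out3 = concat (map (encode_set n) (As (Suc k)))" and r3: "?regs r3"
          using r2 by (auto simp: agree_def out As_Suc)
        show ?case unfolding m3
          by (rule wp_mono[OF wp_next[OF m n]]) (use r3 carry in \<open>auto simp: agree_def\<close>)
      qed (use r2 in auto)
    qed (use r in \<open>auto simp: body_bound_def\<close>)
  qed
  have loop: "wp (While_Less rCarry rOne (minimal_com ;; output_com ;; next_com))
     (1 + (2 ^ n - 0) * (body_bound n + 1)) (?I (2 ^ n)) (r, ?m, [])"
    if "?regs r" "r rCarry = 0" for r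
  proof (rule wp_While[where I = ?I])
    \<comment> \<open>Cells behind the matrix are initially 0, which already encodes the empty
      set.\<close>
    have "holds G (set_decode 0) ?m" by (simp add: holds_def encode_graph_def Let_def n)
    then show "?I 0 (r, ?m, [])" using that by (simp add: As_def)
  next
    fix k r m out assume "k < 2 ^ n" "?I k (r, m, out)"
    then show "r rCarry < r rOne \<and> wp (minimal_com ;; output_com ;; next_com) (body_bound n)
        (?I (Suc k)) (r, m, out)" using body[of k r m out] by simp
  qed auto
  have "?m 0 = n" by (simp add: encode_graph_def n)
  then have "wp enumerate_com (total_bound n) (?I (2 ^ n)) (\<lambda>_. 0, ?m, [])"
    unfolding enumerate_com_def total_bound_def
    by (rule wp_Seq'[OF wp_setup, where ?B2.0 = "1 + (2 ^ n - 0) * (body_bound n + 1)"])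
      (use loop in auto)
  then obtain t s where t: "exec enumerate_com (\<lambda>_. 0, ?m, []) t s" "t \<le> total_bound n" "?I (2 ^ n) s"
    unfolding wp_def by blast
  have "distinct (As (2 ^ n))"
    unfolding As_def by (intro distinct_filter) (simp add: distinct_map inj_onI, metis inj_onI set_decode_inverse)
  moreover have "set (As (2 ^ n)) = loc_min_defensive_alliances G"
  proof -
    have "A \<subseteq> {..<n}" if "loc_min_defensive_alliance G A" for A
      using that G by (auto simp: loc_min_defensive_alliance_def defensive_alliance_def input_graph_def n)
    then show ?thesis
      using set_decode_image[of n] by (auto simp: As_def loc_min_defensive_alliances_def atLeast0LessThan)
  qed
  ultimately have "enumerates_in enumerate_com G t"
    using t unfolding enumerates_in_def computes_in_def
    by (cases s) (auto simp: n intro!: exI[of _ "As (2 ^ n)"])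
  then show ?thesis using t(2) n by auto
qed

lemma total_bound_le: "total_bound n \<le> 100 * (n + 1) ^ 3 * 2 ^ n"
proof -
  have "body_bound n + 1 \<le> 50 * (n + 1) ^ 3"
    by (simp add: body_bound_def power3_eq_cube algebra_simps)
  then have "2 ^ n * (body_bound n + 1) \<le> 50 * (n + 1) ^ 3 * 2 ^ n"
    by (metis mult.commute mult_le_mono2)
  moreover have "6 + n * (4 + n * 3) \<le> 50 * (n + 1) ^ 3 * 1"
    by (simp add: power3_eq_cube algebra_simps)
  then have "6 + n * (4 + n * 3) \<le> 50 * (n + 1) ^ 3 * 2 ^ n"
    by (rule order_trans) (intro mult_le_mono2, simp)
  ultimately show ?thesis by (simp add: total_bound_def)
qed

lemma total_bound_O_star: "(\<lambda>n. real (total_bound n)) \<in> O_star (\<lambda>n. 2 ^ n)"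
proof -
  have "(\<lambda>n. real (total_bound n)) \<in> O(\<lambda>n. poly ([:1, 1:] ^ 3) (real n) * 2 ^ n)"
  proof (rule bigoI[where c = 100], intro always_eventually allI)
    fix n
    have "real (total_bound n) \<le> real (100 * (n + 1) ^ 3 * 2 ^ n)"
      using total_bound_le of_nat_le_iff by blast
    then show "norm (real (total_bound n)) \<le> 100 * norm (poly ([:1, 1:] ^ 3) (real n) * 2 ^ n)"
      by (simp add: add.commute)
  qed
  then show ?thesis unfolding O_star_def by blast
qed

section \<open>The parameters of complete bipartite graphs\<close>

text \<open>This is the complete bipartite graph with sides of size 2 and \<open>m\<close>, not a
  complete graph: 0 and 1 form the small side, and the numbers from 2 on the large side.\<close>

definition K2 :: "nat \<Rightarrow> nat graph" where
  "K2 m = ({..<m + 2}, {{a, b} | a b. a < 2 \<and> 2 \<le> b \<and> b < m + 2})"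

lemma verts_K2 [simp]: "verts (K2 m) = {..<m + 2}" and gorder_K2 [simp]: "gorder (K2 m) = m + 2"
  by (auto simp: K2_def gorder_def)

lemma edges_K2_iff:
  "{u, v} \<in> edges (K2 m) \<longleftrightarrow>
     u < 2 \<and> 2 \<le> v \<and> v < m + 2 \<or> v < 2 \<and> 2 \<le> u \<and> u < m + 2"
  by (auto simp: K2_def doubleton_eq_iff)

lemma edges_K2D: "e \<in> edges (K2 m) \<Longrightarrow> \<exists>a b. e = {a, b} \<and> a < 2 \<and> 2 \<le> b \<and> b < m + 2"
  by (auto simp: K2_def)

lemma input_graph_K2: "input_graph (K2 m)"
  unfolding input_graph_def simple_graph_def
proof (intro conjI ballI)
  fix e assume "e \<in> edges (K2 m)"
  then obtain a b where "e = {a, b}" "a < 2" "2 \<le> b" "b < m + 2" using edges_K2D by blast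
  then show "\<exists>u v. u \<in> verts (K2 m) \<and> v \<in> verts (K2 m) \<and> u \<noteq> v \<and> e = {u, v}"
    by (intro exI[of _ a] exI[of _ b]) auto
qed auto

lemma complete_bipartite_K2:
  assumes "m > 0" shows "complete_bipartite (K2 m)"
  unfolding complete_bipartite_def
  by (rule exI[of _ "{..<2}"], rule exI[of _ "{2..<m + 2}"]) (use assms in \<open>auto simp: K2_def lessThan_empty_iff\<close>)

lemma nbh_K2: "v < m + 2 \<Longrightarrow> nbh (K2 m) v = (if v < 2 then {2..<m + 2} else {..<2})"
  by (auto simp: nbh_def edges_K2_iff)

lemma neighborhood_diversity_K2:
  assumes "m \<ge> 2" shows "neighborhood_diversity (K2 m) = 2"
proof -
  have rel: "twin_rel (K2 m) = {(u, v). u < m + 2 \<and> v < m + 2 \<and> (u < 2 \<longleftrightarrow> v < 2)}"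
  proof -
    have "nbh (K2 m) v - {u} = nbh (K2 m) u - {v} \<longleftrightarrow> (u < 2 \<longleftrightarrow> v < 2)"
      if "u < m + 2" "v < m + 2" for u v
    proof (cases "u < 2"; cases "v < 2")
      assume "u < 2" "\<not> v < 2"
      \<comment> \<open>\<open>1 - u\<close> is the other vertex of the small side: adjacent to
        \<open>v\<close>, but not to \<open>u\<close>.\<close>
      then have "(1 - u) \<in> nbh (K2 m) v - {u}" "1 - u \<notin> nbh (K2 m) u"
        using that by (auto simp: nbh_K2 less_2_cases_iff)
      then show ?thesis using \<open>u < 2\<close> \<open>\<not> v < 2\<close> by blast
    next
      assume "\<not> u < 2" "v < 2"
      then have "(1 - v) \<in> nbh (K2 m) u - {v}" "1 - v \<notin> nbh (K2 m) v"
        using that by (auto simp: nbh_K2 less_2_cases_iff)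
      then show ?thesis using \<open>v < 2\<close> \<open>\<not> u < 2\<close> by blast
    qed (use that in \<open>auto simp: nbh_K2\<close>)
    then show ?thesis by (auto simp: twin_rel_def)
  qed
  have im: "twin_rel (K2 m) `` {v} = (if v < 2 then {..<2} else {2..<m + 2})" if "v < m + 2" for v
    using that by (auto simp: rel)
  have "verts (K2 m) // twin_rel (K2 m) = (\<lambda>v. twin_rel (K2 m) `` {v}) ` {..<m + 2}"
    by (auto simp: quotient_def)
  also have "\<dots> = (\<lambda>v. if v < 2 then {..<2} else {2..<m + 2}) ` {..<m + 2}"
    by (intro image_cong) (auto simp: im)
  also have "\<dots> = {{..<2}, {2..<m + 2}}"
  proof -
    have 1: "{..<m + 2} = {..<2} \<union> {2..<m + 2}" by auto
    have 2: "(\<lambda>v. if v < 2 then {..<2} else {2..<m + 2}) ` {..<2::nat} = {{..<2}}"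
      by (auto intro!: image_eqI[of _ _ 0])
    have 3: "(\<lambda>v. if v < 2 then {..<2} else {2..<m + 2}) ` {2..<m + 2} = {{2..<m + 2}}"
      using assms by (auto intro!: image_eqI[of _ _ 2])
    show ?thesis unfolding 1 image_Un 2 3 by (rule insert_is_Un[symmetric])
  qed
  finally have "neighborhood_diversity (K2 m) = card {{..<2}, {2..<m + 2}}"
    by (simp add: neighborhood_diversity_def)
  moreover have "{..<2::nat} \<noteq> {2..<m + 2}"
    using assms by (metis atLeastLessThan_iff lessThan_iff not_numeral_le_zero zero_less_numeral)
  ultimately show ?thesis by simp
qed

section \<open>Vertex cover number and twin-cover number\<close>

lemma card_ge_2I: "finite X \<Longrightarrow> x \<in> X \<Longrightarrow> y \<in> X \<Longrightarrow> x \<noteq> y \<Longrightarrow> 2 \<le> card X"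
  using card_mono[of X "{x, y}"] by simp

lemma card_ge_3I:
  "finite X \<Longrightarrow> x \<in> X \<Longrightarrow> y \<in> X \<Longrightarrow> z \<in> X \<Longrightarrow> x \<noteq> y \<Longrightarrow> y \<noteq> z \<Longrightarrow> x \<noteq> z \<Longrightarrow> 3 \<le> card X"
  using card_mono[of X "{x, y, z}"] by simp

lemma vertex_cover_K2: "vertex_cover (K2 m) {..<2}"
  by (auto simp: vertex_cover_def edges_K2_iff)

text \<open>The edges 02 and 13 are disjoint, and each needs a cover vertex of its own.\<close>

lemma vertex_cover_K2_card:
  assumes "m \<ge> 2" "vertex_cover (K2 m) X" shows "2 \<le> card X"
proof -
  have X: "finite X" using assms(2) finite_subset by (fastforce simp: vertex_cover_def)
  have "0 \<in> X \<or> 2 \<in> X" "1 \<in> X \<or> 3 \<in> X"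
    using assms by (auto simp: vertex_cover_def edges_K2_iff)
  then show ?thesis
    using card_ge_2I[OF X, of 0 1] card_ge_2I[OF X, of 0 3] card_ge_2I[OF X, of 2 1]
      card_ge_2I[OF X, of 2 3] by auto
qed

lemma vertex_cover_number_K2:
  assumes "m \<ge> 2" shows "vertex_cover_number (K2 m) = 2"
  unfolding vertex_cover_number_def
  by (rule Least_equality)
    (use vertex_cover_K2[of m] vertex_cover_K2_card[OF assms] in \<open>auto intro!: exI[of _ "{..<2}"]\<close>)

text \<open>No edge joins twins: for \<open>u\<close> on the small side, the other small vertex
  \<open>1 - u\<close> separates the closed neighbourhoods of its endpoints. So the twin alternative
  never applies.\<close>

lemma twin_cover_K2_iff:
  assumes "m \<ge> 2" shows "twin_cover (K2 m) X \<longleftrightarrow> vertex_cover (K2 m) X"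
proof -
  have *: "closed_nbh (K2 m) u \<noteq> closed_nbh (K2 m) v" if "u < 2" "2 \<le> v" "v < m + 2" for u v
  proof -
    have "1 - u \<in> closed_nbh (K2 m) v" "1 - u \<notin> closed_nbh (K2 m) u"
      using that by (auto simp: closed_nbh_def nbh_K2 less_2_cases_iff)
    then show ?thesis by blast
  qed
  have **: "closed_nbh (K2 m) u \<noteq> closed_nbh (K2 m) v" if "{u, v} \<in> edges (K2 m)" for u v
    using that *[of u v] *[of v u] by (auto simp: edges_K2_iff)
  then show ?thesis by (simp add: twin_cover_def vertex_cover_def cong: imp_cong)
qed

lemma twin_cover_number_K2: "m \<ge> 2 \<Longrightarrow> twin_cover_number (K2 m) = 2"
  using vertex_cover_number_K2 by (simp add: twin_cover_number_def vertex_cover_number_def twin_cover_K2_iff)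

section \<open>Treedepth\<close>

text \<open>All three vertices lie on the path from \<open>u\<close> to its root, and acyclicity
  keeps them distinct.\<close>

lemma forest_depth_ge_3_if_chain:
  assumes "rooted_forest V P" "finite V" "(u, v) \<in> P\<^sup>+" "(v, w) \<in> P\<^sup>+"
  shows "3 \<le> forest_depth V P"
proof -
  have P: "P \<subseteq> V \<times> V" "acyclic P" using assms by (auto simp: rooted_forest_def)
  then have PV: "P\<^sup>+ \<subseteq> V \<times> V" by (intro trancl_subset_Sigma)
  then have u: "u \<in> V" using assms(3) by auto
  have "P\<^sup>* `` {u} \<subseteq> V" using u PV by (auto simp: rtrancl_eq_or_trancl)
  then have fin: "finite (P\<^sup>* `` {u})" using assms(2) finite_subset by blast
  have "(u, w) \<in> P\<^sup>+" using assms by (metis trancl_trans)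
  then have "u \<noteq> v" "v \<noteq> w" "u \<noteq> w" using P(2) assms(3,4) by (auto simp: acyclic_def)
  moreover have "u \<in> P\<^sup>* `` {u}" "v \<in> P\<^sup>* `` {u}" "w \<in> P\<^sup>* `` {u}"
    using assms(3) \<open>(u, w) \<in> P\<^sup>+\<close> by (auto intro: trancl_into_rtrancl)
  ultimately have "3 \<le> card (P\<^sup>* `` {u})" using card_ge_3I[OF fin] by metis
  also have "\<dots> \<le> forest_depth V P"
    unfolding forest_depth_def using assms(2) u by (intro Max_ge) auto
  finally show ?thesis .
qed

lemma trancl_one_step:
  assumes "(u, v) \<in> P\<^sup>+" "(u, v) \<notin> P" shows "\<exists>w. (u, w) \<in> P\<^sup>+ \<and> (w, v) \<in> P\<^sup>+"
  using assms by (metis tranclE r_into_trancl)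

text \<open>Depth at most 2 forbids two consecutive ancestor steps. Then ancestors are parents, and
  a vertex has at most one of them, so the ancestor relation forms disjoint stars. The path 3-0-2-1,
  part of the four-cycle, does not fit into a star.\<close>

lemma elimination_forest_K2_depth:
  assumes m: "m \<ge> 2" and P: "elimination_forest (K2 m) P"
  shows "3 \<le> forest_depth (verts (K2 m)) P"
proof (rule ccontr)
  let ?V = "verts (K2 m)"
  assume *: "\<not> 3 \<le> forest_depth ?V P"
  have F: "rooted_forest ?V P" using P by (simp add: elimination_forest_def)
  have chain: False if "(u, v) \<in> P\<^sup>+" "(v, w) \<in> P\<^sup>+" for u v w
    using forest_depth_ge_3_if_chain[OF F _ that] * by simp
  have P1: "(u, v) \<in> P" if "(u, v) \<in> P\<^sup>+" for u v
    using trancl_one_step[OF that] chain by blast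
  have sv: "v = w" if "(u, v) \<in> P\<^sup>+" "(u, w) \<in> P\<^sup>+" for u v w
    using F P1[OF that(1)] P1[OF that(2)] by (auto simp: rooted_forest_def single_valued_def)
  have edge: "(u, v) \<in> P\<^sup>+ \<or> (v, u) \<in> P\<^sup>+" if "u < 2" "2 \<le> v" "v < m + 2" for u v
    using P that by (auto simp: elimination_forest_def edges_K2_iff)
  have "(0, 2) \<in> P\<^sup>+ \<or> (2, 0) \<in> P\<^sup>+" "(0, 3) \<in> P\<^sup>+ \<or> (3, 0) \<in> P\<^sup>+"
    "(1, 2) \<in> P\<^sup>+ \<or> (2, 1) \<in> P\<^sup>+"
    using m edge[of 0 2] edge[of 0 3] edge[of 1 2] by simp_all
  then show False using chain sv[of 0 2 3] sv[of 2 0 1] by auto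
qed

lemma elimination_forest_K2:
  assumes m: "m \<ge> 2"
  shows "\<exists>P. elimination_forest (K2 m) P \<and> forest_depth (verts (K2 m)) P = 3"
proof -
  \<comment> \<open>The root 0 has the only child 1, and the whole large side hangs below 1. Every
    parent is smaller than its child, which yields acyclicity through
    \<open>measure id\<close>.\<close>
  define P :: "(nat \<times> nat) set" where "P = insert (1, 0) ({2..<m + 2} \<times> {1})"
  have step: "(v, u) \<in> P \<longleftrightarrow> v = 1 \<and> u = 0 \<or> 2 \<le> v \<and> v < m + 2 \<and> u = 1" for u v
    by (auto simp: P_def)
  have "P\<inverse> \<subseteq> measure id" by (auto simp: P_def)
  then have "acyclic (P\<inverse>)" using wf_acyclic wf_subset wf_measure by blast
  then have acyc: "acyclic P" by simp
  have img: "P\<^sup>* `` {v} \<subseteq> {v, 1, 0}" for v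
  proof
    fix u assume "u \<in> P\<^sup>* `` {v}"
    then have "(v, u) \<in> P\<^sup>*" by simp
    then show "u \<in> {v, 1, 0}" by (induction rule: rtrancl_induct) (auto simp: step)
  qed
  have low: "(1, 0) \<in> P\<^sup>+" "2 \<le> v \<Longrightarrow> v < m + 2 \<Longrightarrow> (v, 1) \<in> P\<^sup>+" for v
    by (auto simp: step intro: r_into_trancl)
  have P: "elimination_forest (K2 m) P"
    unfolding elimination_forest_def rooted_forest_def
  proof (intro conjI allI impI)
    fix u v assume "{u, v} \<in> edges (K2 m)"
    then have "u < 2 \<and> 2 \<le> v \<and> v < m + 2 \<or> v < 2 \<and> 2 \<le> u \<and> u < m + 2"
      by (simp add: edges_K2_iff)
    moreover have "(v, u) \<in> P\<^sup>+" if "u < 2" "2 \<le> v" "v < m + 2" for u v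
      using that low(2)[OF that(2,3)] trancl_trans[OF low(2)[OF that(2,3)] low(1)]
      by (auto simp: less_2_cases_iff)
    ultimately show "(u, v) \<in> P\<^sup>+ \<or> (v, u) \<in> P\<^sup>+" by blast
  qed (use acyc m in \<open>auto simp: P_def single_valued_def\<close>)
  have "card (P\<^sup>* `` {v}) \<le> 3" for v
  proof -
    have "card (P\<^sup>* `` {v}) \<le> card {v, 1, 0}" by (rule card_mono[OF _ img]) simp
    also have "\<dots> \<le> 3" using card_insert_le_m1[of 3 "{1, 0}" v] by simp
    finally show ?thesis .
  qed
  then have "forest_depth (verts (K2 m)) P \<le> 3"
    unfolding forest_depth_def by (intro Max.boundedI) auto
  with elimination_forest_K2_depth[OF m P] P show ?thesis by (intro exI[of _ P]) auto
qed

lemma treedepth_K2: "m \<ge> 2 \<Longrightarrow> treedepth (K2 m) = 3"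
  unfolding treedepth_def
  by (rule Least_equality) (use elimination_forest_K2 elimination_forest_K2_depth in auto)

section \<open>Cliquewidth and cographs\<close>

text \<open>Only \<open>join\<close> creates edges, and it asks for two distinct labels below
  \<open>k\<close>.\<close>

lemma cw_constructible_1_edges: "cw_constructible k G l \<Longrightarrow> k \<le> 1 \<Longrightarrow> edges G = {}"
  by (induction rule: cw_constructible.induct) auto

lemma cw_constructible_independent:
  assumes "finite V" "V \<noteq> {}" "i < k"
  shows "\<exists>l. cw_constructible k (V, {}) l \<and> (\<forall>v\<in>V. l v = i)"
  using assms(1,2)
proof (induction rule: finite_ne_induct)
  case (singleton v)
  show ?case using cw_constructible.single[OF assms(3)] by (intro exI[of _ "\<lambda>_. i"]) simp
next
  case (insert v V)
  then obtain l where l: "cw_constructible k (V, {}) l" "\<forall>v\<in>V. l v = i" by blast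
  show ?case
    using cw_constructible.union[OF cw_constructible.single[OF assms(3), of v] l(1)] insert.hyps l(2)
    by (intro exI[of _ "\<lambda>u. if u \<in> {v} then i else l u"]) auto
qed

text \<open>The small side gets label 0 and the large side label 1; a single \<open>join\<close>
  then adds all edges.\<close>

lemma cw_constructible_K2:
  assumes "m > 0" shows "\<exists>l. cw_constructible 2 (K2 m) l"
proof -
  obtain l1 where l1: "cw_constructible 2 ({..<2::nat}, {}) l1" "\<forall>v\<in>{..<2}. l1 v = 0"
    using cw_constructible_independent[of "{..<2::nat}" 0 2] by (auto simp: lessThan_empty_iff)
  obtain l2 where l2: "cw_constructible 2 ({2..<m + 2}, {}) l2" "\<forall>v\<in>{2..<m + 2}. l2 v = 1"
    using cw_constructible_independent[of "{2..<m + 2}" 1 2] assms by auto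
  let ?l = "\<lambda>v. if v \<in> {..<2} then l1 v else l2 v"
  have "cw_constructible 2 ({..<2} \<union> {2..<m + 2}, {} \<union> {}) ?l"
    using l1 l2 by (intro cw_constructible.union) auto
  then have "cw_constructible 2 ({..<2} \<union> {2..<m + 2}, ({} \<union> {}) \<union>
      {{u, v} | u v. u \<in> {..<2} \<union> {2..<m + 2} \<and> v \<in> {..<2} \<union> {2..<m + 2} \<and> ?l u = 0 \<and> ?l v = 1}) ?l"
    by (intro cw_constructible.join) auto
  then have *: "cw_constructible 2 ({..<2} \<union> {2..<m + 2},
      {{u, v} | u v. u \<in> {..<2} \<union> {2..<m + 2} \<and> v \<in> {..<2} \<union> {2..<m + 2} \<and> ?l u = 0 \<and> ?l v = 1}) ?l"
    unfolding Un_empty_left .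
  have V: "{..<2} \<union> {2..<m + 2} = {..<m + 2}" by auto
  have E: "{{u, v} | u v. u \<in> {..<m + 2} \<and> v \<in> {..<m + 2} \<and> ?l u = 0 \<and> ?l v = 1} =
      {{a, b} | a b. a < 2 \<and> 2 \<le> b \<and> b < m + 2}"
  proof -
    have "u \<in> {..<m + 2} \<and> v \<in> {..<m + 2} \<and> ?l u = 0 \<and> ?l v = 1 \<longleftrightarrow>
        u < 2 \<and> 2 \<le> v \<and> v < m + 2" for u v
      using l1(2) l2(2) by (cases "u < 2"; cases "v < 2") auto
    then show ?thesis by presburger
  qed
  show ?thesis unfolding K2_def using *[unfolded V E] by blast
qed

lemma cliquewidth_K2:
  assumes "m > 0" shows "cliquewidth (K2 m) = 2"
  unfolding cliquewidth_def
proof (rule Least_equality)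
  fix k assume "\<exists>l. cw_constructible k (K2 m) l"
  moreover have "{0, 2} \<in> edges (K2 m)" using assms by (simp add: edges_K2_iff)
  ultimately show "2 \<le> k" using cw_constructible_1_edges[of k "K2 m"] by (cases "k \<le> 1") auto
qed (rule cw_constructible_K2[OF assms])

lemma cograph_independent:
  assumes "finite V" "V \<noteq> {}" shows "cograph (V, {})"
  using assms
proof (induction rule: finite_ne_induct)
  case (insert v V)
  then show ?case using cograph.union[OF cograph.single[of v], of V "{}"] by simp
qed (rule cograph.single)

text \<open>The graph is the complement of two disjoint cliques, each of which is the complement of
  an independent set.\<close>

lemma cograph_K2:
  assumes "m > 0" shows "cograph (K2 m)"
proof -
  let ?K = "\<lambda>V :: nat set. {{u, v} | u v. u \<in> V \<and> v \<in> V \<and> u \<noteq> v}"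
  have clique: "cograph (V, ?K V)" if "finite V" "V \<noteq> {}" for V
    using cograph.complement[OF cograph_independent[OF that]] by simp
  have "cograph ({..<2} \<union> {2..<m + 2}, ?K {..<2} \<union> ?K {2..<m + 2})"
    using assms by (intro cograph.union clique) (auto simp: lessThan_empty_iff)
  then have *: "cograph ({..<2} \<union> {2..<m + 2}, ?K ({..<2} \<union> {2..<m + 2}) - (?K {..<2} \<union> ?K {2..<m + 2}))"
    by (rule cograph.complement)
  have V: "{..<2} \<union> {2..<m + 2} = {..<m + 2}" by auto
  have E: "?K {..<m + 2} - (?K {..<2} \<union> ?K {2..<m + 2}) =
      {{a, b} | a b. a < 2 \<and> 2 \<le> b \<and> b < m + 2}" (is "?A = ?B")
  proof
    show "?A \<subseteq> ?B"
    proof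
      fix e assume e: "e \<in> ?A"
      then obtain u v where uv: "e = {u, v}" "u < m + 2" "v < m + 2" "u \<noteq> v" by auto
      have "(u < 2) \<noteq> (v < 2)"
      proof
        assume "(u < 2) = (v < 2)"
        then have "e \<in> ?K {..<2} \<or> e \<in> ?K {2..<m + 2}" using uv by (cases "u < 2") force+
        then show False using e by blast
      qed
      then have "e = {u, v} \<and> u < 2 \<and> 2 \<le> v \<and> v < m + 2 \<or> e = {v, u} \<and> v < 2 \<and> 2 \<le> u \<and> u < m + 2"
        using uv by auto
      then show "e \<in> ?B" by blast
    qed
    show "?B \<subseteq> ?A" by (auto simp: doubleton_eq_iff) force
  qed
  show ?thesis unfolding K2_def using *[unfolded V E] .
qed

section \<open>Pathwidth\<close>

lemma path_decomposition_K2_width: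
  assumes m: "m \<ge> 2" and Bs: "path_decomposition (K2 m) Bs"
  shows "2 \<le> path_decomposition_width Bs"
proof (rule ccontr)
  assume *: "\<not> ?thesis"
  have small: "card (Bs ! i) < 3 \<and> finite (Bs ! i)" if "i < length Bs" for i
  proof -
    have "Bs ! i \<in> set Bs" using that by simp
    then have "card (Bs ! i) \<le> Max (card ` set Bs)" by (intro Max_ge) auto
    moreover have "Bs ! i \<subseteq> verts (K2 m)"
      using Bs \<open>Bs ! i \<in> set Bs\<close> unfolding path_decomposition_def by blast
    then have "finite (Bs ! i)" by (rule finite_subset) simp
    ultimately show ?thesis using * by (auto simp: path_decomposition_width_def)
  qed
  have no3: False if "i < length Bs" "x \<in> Bs ! i" "y \<in> Bs ! i" "z \<in> Bs ! i" "x \<noteq> y" "y \<noteq> z" "x \<noteq> z" for i x y z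
    using card_ge_3I[OF _ that(2-7)] small[OF that(1)] by linarith
  have conv: "x \<in> Bs ! j" if "x \<in> Bs ! i" "x \<in> Bs ! k" "i \<le> j" "j \<le> k" "k < length Bs" for i j k x
    using Bs that unfolding path_decomposition_def by blast
  have edge: "\<exists>i<length Bs. a \<in> Bs ! i \<and> b \<in> Bs ! i" if "a < 2" "2 \<le> b" "b < m + 2" for a b
  proof -
    have "{a, b} \<in> edges (K2 m)" using that by (simp add: edges_K2_iff)
    then show ?thesis using Bs unfolding path_decomposition_def by (metis in_set_conv_nth insert_subset)
  qed
  \<comment> \<open>Suppose the bag of edge \<open>ab\<close> comes no later than those of the
    incident edges \<open>ab'\<close> and \<open>a'b\<close>. The earlier of these two lies between
    the first bag and the other one, so it inherits \<open>b\<close> or \<open>a\<close>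
    respectively as a third element.\<close>
  have first: False if "i < length Bs" "j < length Bs" "k < length Bs" "i \<le> j" "i \<le> k"
    "{a, b} \<subseteq> Bs ! i" "{a, b'} \<subseteq> Bs ! j" "{a', b} \<subseteq> Bs ! k"
    "a \<noteq> b" "a \<noteq> b'" "a' \<noteq> b" "a \<noteq> a'" "b \<noteq> b'" for i j k a a' b b'
  proof (cases "j \<le> k")
    case True
    then have "b \<in> Bs ! j" using conv[of b i k j] that by auto
    then show False using no3[of j a b b'] that by auto
  next
    case False
    then have "a \<in> Bs ! k" using conv[of a i j k] that by auto
    then show False using no3[of k a b a'] that by auto
  qed
  obtain i where i: "i < length Bs" "0 \<in> Bs ! i" "2 \<in> Bs ! i" using edge[of 0 2] m by auto
  obtain j where j: "j < length Bs" "0 \<in> Bs ! j" "3 \<in> Bs ! j" using edge[of 0 3] m by auto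
  obtain k where k: "k < length Bs" "1 \<in> Bs ! k" "2 \<in> Bs ! k" using edge[of 1 2] m by auto
  obtain l where l: "l < length Bs" "1 \<in> Bs ! l" "3 \<in> Bs ! l" using edge[of 1 3] m by auto
  \<comment> \<open>A leftmost one among the four bags precedes the bags of both edges of the cycle
    that are incident with its own edge.\<close>
  consider "i \<le> j" "i \<le> k" | "j \<le> i" "j \<le> l" | "k \<le> i" "k \<le> l" | "l \<le> j" "l \<le> k" by linarith
  then show False
  proof cases
    case 1 then show False using first[of i j k 0 2 3 1] i j k by auto
  next
    case 2 then show False using first[of j i l 0 3 2 1] i j l by auto
  next
    case 3 then show False using first[of k l i 1 2 3 0] i k l by auto
  next
    case 4 then show False using first[of l k j 1 3 2 0] j k l by auto
  qed
qed

lemma path_decomposition_K2: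
  assumes m: "m > 0"
  shows "\<exists>Bs. path_decomposition (K2 m) Bs \<and> path_decomposition_width Bs = 2"
proof -
  define Bs where "Bs = map (\<lambda>i. {0, 1, i + 2}) [0..<m]"
  have card: "card ` set Bs = {3}"
  proof -
    have "card ` set Bs = (\<lambda>i. card {0, 1, i + 2}) ` {0..<m}"
      by (simp only: Bs_def set_map set_upt image_image)
    also have "\<dots> = (\<lambda>i. 3) ` {0..<m}" by (intro image_cong) auto
    also have "\<dots> = {3}" using m by (simp add: image_constant_conv)
    finally show ?thesis .
  qed
  have U: "\<Union> (set Bs) = verts (K2 m)"
  proof
    show "verts (K2 m) \<subseteq> \<Union> (set Bs)"
    proof
      fix v assume v: "v \<in> verts (K2 m)"
      show "v \<in> \<Union> (set Bs)"
      proof (cases "v < 2")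
        case True
        then show ?thesis using m by (auto simp: Bs_def less_2_cases_iff)
      next
        case False
        then have "v - 2 < m" "v = (v - 2) + 2" using v by auto
        then show ?thesis by (auto simp: Bs_def intro!: bexI[of _ "v - 2"])
      qed
    qed
  qed (auto simp: Bs_def)
  have E: "\<exists>B\<in>set Bs. e \<subseteq> B" if edge: "e \<in> edges (K2 m)" for e
  proof -
    obtain a b where e: "e = {a, b}" "a < 2" "2 \<le> b" "b < m + 2" using edges_K2D[OF edge] by blast
    then have "e \<subseteq> {0, 1, (b - 2) + 2}" "b - 2 < m" by auto
    then show ?thesis unfolding Bs_def by fastforce
  qed
  have C: "Bs ! i \<inter> Bs ! k \<subseteq> Bs ! j" if "i \<le> j" "j \<le> k" "k < length Bs" for i j k
    using that by (auto simp: Bs_def)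
  have "path_decomposition (K2 m) Bs"
    unfolding path_decomposition_def using U E C m by (auto simp: Bs_def)
  moreover have "path_decomposition_width Bs = 2" by (simp add: path_decomposition_width_def card)
  ultimately show ?thesis by blast
qed

lemma pathwidth_K2: "m \<ge> 2 \<Longrightarrow> pathwidth (K2 m) = 2"
  unfolding pathwidth_def
  by (rule Least_equality) (use path_decomposition_K2 path_decomposition_K2_width in auto)

section \<open>Treewidth\<close>

lemma adj_sym: "(u, v) \<in> adj G \<Longrightarrow> (v, u) \<in> adj G"
  by (simp add: adj_def insert_commute)

text \<open>A walk is shortened while it is extended at the front: if the new start \<open>y\<close>
  already occurs, everything before that occurrence is dropped.\<close>

lemma rtrancl_distinct_path:
  assumes "(s, t) \<in> R\<^sup>*"
  shows "\<exists>xs. xs \<noteq> [] \<and> hd xs = s \<and> last xs = t \<and> distinct xs \<and> successively (\<lambda>x y. (x, y) \<in> R) xs"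
  using assms
proof (induction rule: converse_rtrancl_induct)
  case base
  show ?case by (intro exI[of _ "[t]"]) simp
next
  case (step y z)
  then obtain xs where xs: "xs \<noteq> []" "hd xs = z" "last xs = t" "distinct xs"
    "successively (\<lambda>x y. (x, y) \<in> R) xs" by blast
  show ?case
  proof (cases "y \<in> set xs")
    case True
    then obtain ys zs where "xs = ys @ y # zs" by (meson split_list)
    then show ?thesis using xs
      by (intro exI[of _ "y # zs"]) (auto simp: successively_append_iff)
  next
    case False
    then show ?thesis using xs step.hyps(1)
      by (intro exI[of _ "y # xs"]) (auto simp: successively_Cons)
  qed
qed

text \<open>A connection avoiding the edge contains a path, which the edge would close to a
  cycle.\<close>

lemma tree_edge_is_bridge:
  assumes T: "tree T" and st: "(s, t) \<in> adj T"
  shows "(s, t) \<notin> (adj T - {(s, t), (t, s)})\<^sup>*"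
proof
  assume "(s, t) \<in> (adj T - {(s, t), (t, s)})\<^sup>*"
  then obtain xs where xs: "xs \<noteq> []" "hd xs = s" "last xs = t" "distinct xs"
    and "successively (\<lambda>x y. (x, y) \<in> adj T - {(s, t), (t, s)}) xs"
    using rtrancl_distinct_path[of s t "adj T - {(s, t), (t, s)}"] by blast
  then have step: "(xs ! i, xs ! Suc i) \<in> adj T - {(s, t), (t, s)}" if "Suc i < length xs" for i
    using that by (simp add: successively_conv_nth)
  have "s \<noteq> t"
    using T st by (auto simp: tree_def simple_graph_def adj_def doubleton_eq_iff)
  have s: "xs ! 0 = s" and t: "xs ! (length xs - 1) = t"
    using xs by (simp_all add: hd_conv_nth last_conv_nth)
  have "length xs \<noteq> 1" using s t \<open>s \<noteq> t\<close> by auto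
  \<comment> \<open>A path of two vertices would be the removed edge itself. This secures the length
    3 that \<open>graph_cycle\<close> demands.\<close>
  moreover have "length xs \<noteq> 2" using step[of 0] s t by auto
  moreover have "length xs \<noteq> 0" using xs by simp
  ultimately have len: "3 \<le> length xs" by linarith
  have "(xs ! i, xs ! (Suc i mod length xs)) \<in> adj T" if "i < length xs" for i
  proof (cases "Suc i = length xs")
    case True
    then show ?thesis using adj_sym[OF st] s t by (auto simp: diff_Suc_1 dest: sym)
  next
    case False
    then show ?thesis using step[of i] that by simp
  qed
  then have "graph_cycle T xs" using len xs by (simp add: graph_cycle_def)
  then show False using T by (auto simp: tree_def)
qed

text \<open>Any walk either avoids \<open>X\<close> altogether or has a last exit from
  \<open>X\<close>; the disjunction is what survives prepending a step. Taking the last exit, not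
  the first, makes the rest of the walk avoid \<open>X\<close>.\<close>

lemma rtrancl_last_exit:
  assumes "(x, y) \<in> R\<^sup>*" "x \<in> X" "y \<notin> X"
  shows "\<exists>s s'. (s, s') \<in> R \<and> s \<in> X \<and> s' \<notin> X \<and> (s', y) \<in> (R \<inter> (- X) \<times> (- X))\<^sup>*"
proof -
  have "x \<notin> X \<and> (x, y) \<in> (R \<inter> (- X) \<times> (- X))\<^sup>* \<or>
      (\<exists>s s'. (s, s') \<in> R \<and> s \<in> X \<and> s' \<notin> X \<and> (s', y) \<in> (R \<inter> (- X) \<times> (- X))\<^sup>*)"
    using assms(1)
  proof (induction rule: converse_rtrancl_induct)
    case base
    then show ?case using assms(3) by simp
  next
    case (step u v)
    then show ?case
      by (cases "u \<in> X") (auto intro: converse_rtrancl_into_rtrancl)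
  qed
  then show ?thesis using assms(2) by blast
qed

text \<open>If all bags had at most two elements, consider the walk in the subtree of \<open>2\<close> from a bag of the
  edge \<open>02\<close> to one of \<open>12\<close>, and the last tree edge on it at which it leaves the subtree of \<open>0\<close>. The
  walk back through the subtrees of \<open>1\<close>, \<open>3\<close> and \<open>0\<close> bypasses that edge, but it must be a bridge.\<close>

lemma tree_decomposition_K2_width:
  assumes m: "m \<ge> 2" and D: "tree_decomposition (K2 m) T B"
  shows "2 \<le> tree_decomposition_width T B"
proof (rule ccontr)
  assume *: "\<not> ?thesis"
  have T: "tree T" and simple: "simple_graph T" using D by (auto simp: tree_decomposition_def tree_def)
  have adjV: "s \<in> verts T \<and> t \<in> verts T" if "(s, t) \<in> adj T" for s t
  proof -
    have "{s, t} \<in> edges T" using that by (simp add: adj_def)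
    then obtain u v where "u \<in> verts T" "v \<in> verts T" "{s, t} = {u, v}"
      using simple unfolding simple_graph_def by metis
    then show ?thesis by (auto simp: doubleton_eq_iff)
  qed
  have no3: False if "t \<in> verts T" "x \<in> B t" "y \<in> B t" "z \<in> B t" "x \<noteq> y" "y \<noteq> z" "x \<noteq> z" for t x y z
  proof -
    have "(\<Union>t\<in>verts T. B t) = verts (K2 m)" using D unfolding tree_decomposition_def by (elim conjE)
    then have "B t \<subseteq> verts (K2 m)" using that(1) by (metis UN_upper)
    then have "finite (B t)" by (rule finite_subset) simp
    then have "3 \<le> card (B t)" by (rule card_ge_3I[OF _ that(2-7)])
    also have "card (B t) \<le> Max ((\<lambda>t. card (B t)) ` verts T)"
    proof (rule Max_ge)
      show "finite ((\<lambda>t. card (B t)) ` verts T)" using simple by (simp add: simple_graph_def)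
    qed (rule imageI[OF that(1)])
    finally show False using * unfolding tree_decomposition_width_def by linarith
  qed
  define X where "X v = {t. v \<in> B t}" for v
  have conn: "(s, t) \<in> (adj T \<inter> X v \<times> X v)\<^sup>*"
    if "s \<in> verts T" "t \<in> verts T" "v \<in> B s" "v \<in> B t" "v < m + 2" for s t v
  proof -
    have "graph_connected (induced T (X v))"
      using D that(5) by (simp add: tree_decomposition_def X_def)
    then have "(s, t) \<in> (adj (induced T (X v)))\<^sup>*"
      using that by (simp add: graph_connected_def induced_def X_def)
    moreover have "adj (induced T (X v)) \<subseteq> adj T \<inter> X v \<times> X v"
      by (auto simp: adj_def induced_def)
    ultimately show ?thesis using set_mp[OF rtrancl_mono] by blast
  qed
  have edge: "\<exists>t\<in>verts T. a \<in> B t \<and> b \<in> B t" if "a < 2" "2 \<le> b" "b < m + 2" for a b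
  proof -
    have "{a, b} \<in> edges (K2 m)" using that by (simp add: edges_K2_iff)
    moreover have "\<forall>e\<in>edges (K2 m). \<exists>t\<in>verts T. e \<subseteq> B t"
      using D unfolding tree_decomposition_def by (elim conjE)
    ultimately obtain t where "t \<in> verts T" "{a, b} \<subseteq> B t" by blast
    then show ?thesis by auto
  qed
  obtain t02 where t02: "t02 \<in> verts T" "0 \<in> B t02" "2 \<in> B t02" using edge[of 0 2] m by auto
  obtain t03 where t03: "t03 \<in> verts T" "0 \<in> B t03" "3 \<in> B t03" using edge[of 0 3] m by auto
  obtain t12 where t12: "t12 \<in> verts T" "1 \<in> B t12" "2 \<in> B t12" using edge[of 1 2] m by auto
  obtain t13 where t13: "t13 \<in> verts T" "1 \<in> B t13" "3 \<in> B t13" using edge[of 1 3] m by auto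
  have "t12 \<notin> X 0" using no3[of t12 0 1 2] t12 by (auto simp: X_def)
  moreover have "t02 \<in> X 0" using t02 by (simp add: X_def)
  ultimately obtain s s' where s: "(s, s') \<in> adj T \<inter> X 2 \<times> X 2" "s \<in> X 0" "s' \<notin> X 0"
    and s': "(s', t12) \<in> ((adj T \<inter> X 2 \<times> X 2) \<inter> (- X 0) \<times> (- X 0))\<^sup>*"
    using rtrancl_last_exit[OF conn[OF t02(1) t12(1) t02(3) t12(3)], of "X 0"] m by auto
  have sV: "s \<in> verts T" using s(1) adjV by blast
  \<comment> \<open>The bag of \<open>s\<close> contains 0 and 2, so there is no room for a third
    vertex.\<close>
  have "s \<notin> X 1" "s \<notin> X 3"
    using s no3[OF sV, of 0 2 1] no3[OF sV, of 0 2 3] by (auto simp: X_def)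
  \<comment> \<open>Each part of the detour misses an endpoint of the removed edge: the rest of the
    walk in \<open>X 2\<close> avoids \<open>X 0\<close> and so misses \<open>s\<close>, the parts
    in \<open>X 1\<close> and \<open>X 3\<close> miss \<open>s\<close>, and the part in
    \<open>X 0\<close> misses \<open>s'\<close>.\<close>
  define R where "R = adj T - {(s', s), (s, s')}"
  have into_R: "(x, y) \<in> R\<^sup>*" if "(x, y) \<in> (adj T \<inter> X v \<times> X v)\<^sup>*" "s \<notin> X v \<or> s' \<notin> X v" for x y v
  proof -
    have "adj T \<inter> X v \<times> X v \<subseteq> R" using that(2) by (auto simp: R_def)
    then show ?thesis using that(1) by (rule set_mp[OF rtrancl_mono])
  qed
  have "(adj T \<inter> X 2 \<times> X 2) \<inter> (- X 0) \<times> (- X 0) \<subseteq> R" using s(2) by (auto simp: R_def)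
  then have "(s', t12) \<in> R\<^sup>*" using s' by (rule set_mp[OF rtrancl_mono])
  also have "(t12, t13) \<in> R\<^sup>*"
    by (rule into_R[OF conn[of t12 t13 1]]) (use \<open>s \<notin> X 1\<close> t12 t13 in simp_all)
  also have "(t13, t03) \<in> R\<^sup>*"
    by (rule into_R[OF conn[of t13 t03 3]]) (use \<open>s \<notin> X 3\<close> t13 t03 m in simp_all)
  also have "(t03, s) \<in> R\<^sup>*"
    by (rule into_R[OF conn[of t03 s 0]]) (use s(2,3) t03 sV in \<open>simp_all add: X_def\<close>)
  finally have "(s', s) \<in> R\<^sup>*" .
  moreover have "(s', s) \<in> adj T" by (rule adj_sym) (use s(1) in simp)
  ultimately show False using tree_edge_is_bridge[OF T, of s' s] by (simp add: R_def)
qed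

text \<open>The host tree for bags that share 0 and 1 and have one private vertex each. Its shape is
  irrelevant to the bag conditions; with a star, all nodes are within one step of the centre and
  every edge contains the centre.\<close>

definition star :: "nat \<Rightarrow> nat graph" where
  "star m = ({..<m}, {{0, i} | i. 0 < i \<and> i < m})"

lemma adj_star: "(u, v) \<in> adj (star m) \<longleftrightarrow> u = 0 \<and> 0 < v \<and> v < m \<or> v = 0 \<and> 0 < u \<and> u < m"
  by (auto simp: adj_def star_def doubleton_eq_iff)

lemma star_connected:
  assumes "m > 0" shows "graph_connected (star m)"
proof -
  have to: "(u, 0) \<in> (adj (star m))\<^sup>*" if "u < m" for u
    using that by (cases "u = 0") (simp_all add: adj_star r_into_rtrancl)
  have from0: "(0, u) \<in> (adj (star m))\<^sup>*" if "u < m" for u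
    using that by (cases "u = 0") (simp_all add: adj_star r_into_rtrancl)
  have "(u, v) \<in> (adj (star m))\<^sup>*" if "u < m" "v < m" for u v
    using to[OF that(1)] from0[OF that(2)] by (rule rtrancl_trans)
  then show ?thesis using assms by (auto simp: graph_connected_def star_def lessThan_empty_iff)
qed

text \<open>Every edge of a cycle would meet the centre 0, but one position of a cycle lies on only
  two of its edges. Three consecutive edges suffice for the contradiction.\<close>

lemma star_acyclic: "\<not> graph_cycle (star m) c"
proof
  assume c: "graph_cycle (star m) c"
  then have len: "3 \<le> length c" and d: "distinct c" by (auto simp: graph_cycle_def)
  have step: "(c ! i, c ! (Suc i mod length c)) \<in> adj (star m)" if "i < length c" for i
    using c that by (simp add: graph_cycle_def)
  have zero: "c ! i = 0 \<or> c ! (Suc i mod length c) = 0" if "i < length c" for i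
    using step[OF that] by (auto simp: adj_star)
  have unique: "i = j" if "c ! i = 0" "c ! j = 0" "i < length c" "j < length c" for i j
    using d that by (metis nth_eq_iff_index_eq)
  have lt: "0 < length c" "1 < length c" "2 < length c" using len by auto
  have 0: "c ! 0 = 0 \<or> c ! 1 = 0" using zero[of 0] lt by simp
  have 1: "c ! 1 = 0 \<or> c ! 2 = 0" using zero[of 1] lt by (simp add: numeral_2_eq_2)
  have 2: "c ! 2 = 0 \<or> c ! (3 mod length c) = 0" using zero[of 2] lt by (simp add: numeral_3_eq_3)
  \<comment> \<open>The third edge ends at position 0 in a triangle and at position 3 otherwise, so
    it never returns to position 1.\<close>
  have 3: "3 mod length c < length c" "3 mod length c \<noteq> 1"
    using len by (cases "length c = 3"; simp)+
  show False
  proof (cases "c ! 1 = 0")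
    case True
    then have "c ! 2 \<noteq> 0" using unique[of 1 2] lt by auto
    then show False using 2 3 True unique[of 1 "3 mod length c"] lt by auto
  next
    case False
    then show False using 0 1 unique[of 0 2] lt by auto
  qed
qed

lemma tree_star: "m > 0 \<Longrightarrow> tree (star m)"
  using star_connected star_acyclic
  by (auto simp: tree_def simple_graph_def star_def)

lemma tree_decomposition_K2:
  assumes m: "m > 0"
  shows "\<exists>T B. tree_decomposition (K2 m) T B \<and> tree_decomposition_width T B = 2"
proof -
  define B :: "nat \<Rightarrow> nat set" where "B i = {0, 1, i + 2}" for i
  have "tree_decomposition (K2 m) (star m) B"
    unfolding tree_decomposition_def
  proof (intro conjI ballI)
    show "tree (star m)" using m by (rule tree_star)
    show "(\<Union>t\<in>verts (star m). B t) = verts (K2 m)"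
    proof
      show "verts (K2 m) \<subseteq> (\<Union>t\<in>verts (star m). B t)"
      proof
        fix v assume v: "v \<in> verts (K2 m)"
        show "v \<in> (\<Union>t\<in>verts (star m). B t)"
        proof (cases "v < 2")
          case True
          then show ?thesis using m by (auto simp: star_def B_def less_2_cases_iff)
        next
          case False
          then have "v - 2 \<in> verts (star m)" "v \<in> B (v - 2)" using v by (auto simp: star_def B_def)
          then show ?thesis by blast
        qed
      qed
    qed (use m in \<open>auto simp: star_def B_def\<close>)
  next
    fix e assume "e \<in> edges (K2 m)"
    then obtain a b where "e = {a, b}" "a < 2" "2 \<le> b" "b < m + 2" using edges_K2D by blast
    then show "\<exists>t\<in>verts (star m). e \<subseteq> B t"
      by (intro bexI[of _ "b - 2"]) (auto simp: B_def star_def)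
  next
    fix v assume v: "v \<in> verts (K2 m)"
    show "graph_connected (induced (star m) {t. v \<in> B t})"
    proof (cases "v < 2")
      case True
      then have "{t. v \<in> B t} = UNIV" by (auto simp: B_def)
      then show ?thesis using star_connected[OF m] by (simp add: induced_def)
    next
      case False
      then have "{t. v \<in> B t} = {v - 2}" by (auto simp: B_def)
      then show ?thesis using False v by (auto simp: induced_def graph_connected_def star_def)
    qed
  qed
  moreover have "(\<lambda>t. card (B t)) ` verts (star m) = {3}"
    using m by (auto simp: B_def star_def)
  then have "tree_decomposition_width (star m) B = 2"
    by (simp add: tree_decomposition_width_def)
  ultimately show ?thesis by blast
qed

lemma treewidth_K2: "m \<ge> 2 \<Longrightarrow> treewidth (K2 m) = 2"
  unfolding treewidth_def
  by (rule Least_equality) (use tree_decomposition_K2 tree_decomposition_K2_width in auto)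

section \<open>Counting locally minimal defensive alliances\<close>

text \<open>The centre 0 has \<open>k\<close> neighbours inside and \<open>k\<close> outside; a
  member of \<open>S\<close> has 0 inside and 1 outside.\<close>

lemma loc_min_defensive_alliance_K2:
  assumes k: "k > 0" and S: "S \<subseteq> {2..<2 * k + 2}" "card S = k"
  shows "loc_min_defensive_alliance (K2 (2 * k)) (insert 0 S)"
proof -
  let ?G = "K2 (2 * k)"
  have fin: "finite S" using S(1) finite_subset by blast
  have S2: "2 \<le> v \<and> v < 2 * k + 2" if "v \<in> S" for v using S that by auto
  have 0: "0 \<notin> S" using S2[of 0] by auto
  have nbh0: "nbh ?G 0 = {2..<2 * k + 2}" by (simp add: nbh_K2)
  have nbhv: "nbh ?G v = {0, 1}" if "v \<in> S" for v
    using S2[OF that] by (auto simp: nbh_K2 less_2_cases_iff)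
  \<comment> \<open>Stated for all subsets \<open>U\<close> of \<open>S\<close>, since it serves
    both \<open>S\<close> and \<open>S - {v}\<close>.\<close>
  have in0: "deg_in ?G (insert 0 U) 0 = card U"
    "deg_in ?G (verts ?G - insert 0 U) 0 = 2 * k - card U" if "U \<subseteq> S" for U
  proof -
    have U: "U \<subseteq> {2..<2 * k + 2}" using that S by blast
    then have "{2..<2 * k + 2} \<inter> insert 0 U = U"
      "{2..<2 * k + 2} \<inter> (verts ?G - insert 0 U) = {2..<2 * k + 2} - U" by auto
    then show "deg_in ?G (insert 0 U) 0 = card U"
      "deg_in ?G (verts ?G - insert 0 U) 0 = 2 * k - card U"
      using U finite_subset[OF U] by (simp_all add: deg_in_def nbh0 card_Diff_subset)
  qed
  have "defensive_alliance ?G (insert 0 S)"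
    unfolding defensive_alliance_def
  proof (intro conjI ballI)
    fix v assume v: "v \<in> insert 0 S"
    show "deg_in ?G (verts ?G - insert 0 S) v \<le> deg_in ?G (insert 0 S) v + 1"
    proof (cases "v = 0")
      case True
      then show ?thesis using in0[of S] S(2) by simp
    next
      case False
      then have v: "v \<in> S" using v by simp
      have "deg_in ?G (verts ?G - insert 0 S) v \<le> card {1::nat}"
        unfolding deg_in_def nbhv[OF v] by (intro card_mono) auto
      then show ?thesis by simp
    qed
  qed (use S in auto)
  moreover have "\<not> defensive_alliance ?G (insert 0 S - {v})" if v: "v \<in> insert 0 S" for v
  proof (cases "v = 0")
    case True
    then have eq: "insert 0 S - {v} = S" using 0 by auto
    obtain w where w: "w \<in> S" using k S(2) by (metis card.empty equals0I less_irrefl)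
    have "1 \<notin> S" using S2[of 1] by auto
    with 0 have "{0, 1} \<inter> S = {}" "{0, 1} \<inter> (verts ?G - S) = {0, 1}" by auto
    then have "deg_in ?G S w = 0" "deg_in ?G (verts ?G - S) w = 2"
      by (simp_all add: deg_in_def nbhv[OF w])
    \<comment> \<open>Both 0 and 1 are now outside: 2 against \<open>0 + 1\<close>.\<close>
    then have "\<not> deg_in ?G (verts ?G - S) w \<le> deg_in ?G S w + 1" by simp
    then show ?thesis using w unfolding eq defensive_alliance_def by blast
  next
    case False
    then have v: "v \<in> S" using v by simp
    have eq: "insert 0 S - {v} = insert 0 (S - {v})" using False by auto
    have "card (S - {v}) = k - 1" using v S fin by simp
    then have "deg_in ?G (insert 0 (S - {v})) 0 = k - 1"
      "deg_in ?G (verts ?G - insert 0 (S - {v})) 0 = 2 * k - (k - 1)"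
      using in0[of "S - {v}"] by auto
    \<comment> \<open>For the centre this is \<open>k + 1\<close> outside against
      \<open>(k - 1) + 1\<close> inside.\<close>
    then have "\<not> deg_in ?G (verts ?G - insert 0 (S - {v})) 0 \<le> deg_in ?G (insert 0 (S - {v})) 0 + 1"
      using k by simp
    then show ?thesis unfolding eq defensive_alliance_def by blast
  qed
  ultimately show ?thesis unfolding loc_min_defensive_alliance_def by blast
qed

lemma finite_loc_min_defensive_alliances:
  "simple_graph G \<Longrightarrow> finite (loc_min_defensive_alliances G)"
  by (rule finite_subset[of _ "Pow (verts G)"])
    (auto simp: loc_min_defensive_alliances_def loc_min_defensive_alliance_def
      defensive_alliance_def simple_graph_def)

text \<open>With \<open>n = 2k + 2\<close> one has \<open>2 ^ n = 4 * 4 ^ k\<close>. The standard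
  bound for the central binomial coefficient is \<open>4 ^ k / (2k)\<close>, and enlarging
  \<open>2k\<close> to \<open>n + 1\<close> gives the denominator
  \<open>4 * (n + 1)\<close>.\<close>

lemma card_loc_min_defensive_alliances_K2:
  assumes k: "k > 0"
  shows "2 ^ (2 * k + 2) / (4 * (real (2 * k + 2) + 1))
    \<le> real (card (loc_min_defensive_alliances (K2 (2 * k))))"
proof -
  let ?F = "{S. S \<subseteq> {2..<2 * k + 2} \<and> card S = k}"
  have "2 ^ (2 * k + 2) / (4 * (real (2 * k + 2) + 1)) = (4 * 4 ^ k) / (4 * (real (2 * k + 2) + 1))"
    by (simp add: power_add power_mult)
  also have "\<dots> = 4 ^ k / (real (2 * k + 2) + 1)" by (rule mult_divide_mult_cancel_left) simp
  also have "\<dots> \<le> 4 ^ k / (2 * real k)" using k by (intro divide_left_mono) auto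
  also have "\<dots> \<le> real ((2 * k) choose k)" using k by (rule central_binomial_lower_bound)
  also have "(2 * k) choose k = card ?F" by (simp add: n_subsets)
  also have "card ?F = card (insert 0 ` ?F)"
  proof (intro card_image[symmetric] inj_onI)
    fix S S' :: "nat set" assume S: "S \<in> ?F" "S' \<in> ?F" and eq: "insert 0 S = insert 0 S'"
    have "0 \<notin> S" "0 \<notin> S'" using S by auto
    then show "S = S'" using eq by (simp add: insert_ident)
  qed
  also have "real \<dots> \<le> real (card (loc_min_defensive_alliances (K2 (2 * k))))"
  proof (intro of_nat_mono card_mono finite_loc_min_defensive_alliances)
    show "simple_graph (K2 (2 * k))" using input_graph_K2 by (simp add: input_graph_def)
    show "insert 0 ` ?F \<subseteq> loc_min_defensive_alliances (K2 (2 * k))"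
      using loc_min_defensive_alliance_K2[OF k] by (auto simp: loc_min_defensive_alliances_def)
  qed
  finally show ?thesis .
qed

section \<open>Output length as a lower bound on running time\<close>

lemma exec_output_length:
  "exec c s t s' \<Longrightarrow> length (snd (snd s')) \<le> length (snd (snd s)) + t"
  by (induction rule: exec.induct) auto

text \<open>Each step outputs at most one number, and each alliance occupies \<open>gorder G\<close>
  of them. A positive order is required because the sets of a graph without vertices are written as
  empty lists.\<close>

lemma enumerates_in_lower_bound:
  assumes "enumerates_in P G t" "gorder G > 0"
  shows "card (loc_min_defensive_alliances G) \<le> t"
proof -
  obtain As r m where As: "distinct As" "set As = loc_min_defensive_alliances G"
    and "exec P (\<lambda>_. 0, encode_graph G, []) t (r, m, concat (map (encode_set (gorder G)) As))"
    using assms(1) unfolding enumerates_in_def computes_in_def by blast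
  then have "length (concat (map (encode_set (gorder G)) As)) \<le> t"
    using exec_output_length by fastforce
  also have "length (concat (map (encode_set (gorder G)) As)) = length As * gorder G"
    by (induction As) (auto simp: encode_set_def)
  finally have "length As * gorder G \<le> t" .
  moreover have "length As \<le> length As * gorder G" using assms(2) by simp
  ultimately have "length As \<le> t" by (meson order_trans)
  then show ?thesis using As distinct_card[of As] by simp
qed

theorem corollary2:
  "(\<exists>(P :: com) (T :: nat \<Rightarrow> nat).
      (\<lambda>n. real (T n)) \<in> O_star (\<lambda>n. 2 ^ n) \<and>
      (\<forall>G. input_graph G \<longrightarrow> (\<exists>t\<le>T (gorder G). enumerates_in P G t)))
   \<and>
   (\<exists>(F :: nat graph set) (p :: real poly).
      infinite (gorder ` F) \<and>
      (\<forall>n :: nat. poly p (real n) > 0) \<and>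
      (\<forall>G\<in>F.
         input_graph G \<and>
         complete_bipartite G \<and>
         pathwidth G = 2 \<and>
         treewidth G = 2 \<and>
         neighborhood_diversity G = 2 \<and>
         vertex_cover_number G = 2 \<and>
         cliquewidth G = 2 \<and> cograph G \<and>
         twin_cover_number G = 2 \<and>
         treedepth G = 3 \<and>
         real (card (loc_min_defensive_alliances G))
           \<ge> 2 ^ gorder G / poly p (real (gorder G)) \<and>
         (\<forall>(P :: com) (t :: nat). enumerates_in P G t \<longrightarrow>
            real t \<ge> 2 ^ gorder G / poly p (real (gorder G)))))"
proof (intro conjI)
  show "\<exists>(P :: com) (T :: nat \<Rightarrow> nat).
      (\<lambda>n. real (T n)) \<in> O_star (\<lambda>n. 2 ^ n) \<and>
      (\<forall>G. input_graph G \<longrightarrow> (\<exists>t\<le>T (gorder G). enumerates_in P G t))"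
    using enumerates_enumerate_com total_bound_O_star
    by (intro exI[of _ enumerate_com] exI[of _ total_bound]) blast
next
  let ?F = "(\<lambda>k. K2 (2 * k)) ` {0<..}"
  \<comment> \<open>This is \<open>4 + 4n\<close>; the shift by one keeps the polynomial positive at
    \<open>n = 0\<close> as well.\<close>
  let ?p = "[:4, 4:] :: real poly"
  have "gorder ` ?F = (\<lambda>k. 2 * k + 2) ` {0<..}" by (simp add: image_image)
  moreover have "infinite ((\<lambda>k. 2 * k + 2) ` {0::nat<..})"
    by (simp add: finite_image_iff inj_on_def infinite_Ioi)
  ultimately have inf: "infinite (gorder ` ?F)" by simp
  have pos: "\<forall>n :: nat. poly ?p (real n) > 0" by (simp add: add_pos_nonneg)
  have many: "2 ^ gorder (K2 (2 * k)) / poly ?p (real (gorder (K2 (2 * k))))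
      \<le> real (card (loc_min_defensive_alliances (K2 (2 * k))))" if "k > 0" for k
    using card_loc_min_defensive_alliances_K2[OF that] by (simp add: algebra_simps)
  have time: "2 ^ gorder (K2 (2 * k)) / poly ?p (real (gorder (K2 (2 * k)))) \<le> real t"
    if "k > 0" "enumerates_in P (K2 (2 * k)) t" for k P t
  proof -
    have "card (loc_min_defensive_alliances (K2 (2 * k))) \<le> t"
      using enumerates_in_lower_bound[OF that(2)] by simp
    then show ?thesis using many[OF that(1)] by (meson of_nat_mono order_trans)
  qed
  show "\<exists>(F :: nat graph set) (p :: real poly).
      infinite (gorder ` F) \<and>
      (\<forall>n :: nat. poly p (real n) > 0) \<and>
      (\<forall>G\<in>F.
         input_graph G \<and>
         complete_bipartite G \<and>
         pathwidth G = 2 \<and>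
         treewidth G = 2 \<and>
         neighborhood_diversity G = 2 \<and>
         vertex_cover_number G = 2 \<and>
         cliquewidth G = 2 \<and> cograph G \<and>
         twin_cover_number G = 2 \<and>
         treedepth G = 3 \<and>
         real (card (loc_min_defensive_alliances G))
           \<ge> 2 ^ gorder G / poly p (real (gorder G)) \<and>
         (\<forall>(P :: com) (t :: nat). enumerates_in P G t \<longrightarrow>
            real t \<ge> 2 ^ gorder G / poly p (real (gorder G))))"
  proof (intro exI[of _ ?F] exI[of _ ?p] conjI inf pos ballI)
    fix G assume "G \<in> ?F"
    then obtain k where G: "G = K2 (2 * k)" and k: "k > 0" by auto
    then have m: "2 \<le> 2 * k" "0 < 2 * k" by auto
    note parameters = input_graph_K2 complete_bipartite_K2[OF m(2)] pathwidth_K2[OF m(1)]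
      treewidth_K2[OF m(1)] neighborhood_diversity_K2[OF m(1)] vertex_cover_number_K2[OF m(1)]
      cliquewidth_K2[OF m(2)] cograph_K2[OF m(2)] twin_cover_number_K2[OF m(1)] treedepth_K2[OF m(1)]
    show "input_graph G" "complete_bipartite G" "pathwidth G = 2" "treewidth G = 2"
      "neighborhood_diversity G = 2" "vertex_cover_number G = 2" "cliquewidth G = 2" "cograph G"
      "twin_cover_number G = 2" "treedepth G = 3"
      unfolding G by (rule parameters)+
    show "2 ^ gorder G / poly ?p (real (gorder G)) \<le> real (card (loc_min_defensive_alliances G))"
      unfolding G by (rule many[OF k])
    show "\<forall>P t. enumerates_in P G t \<longrightarrow> 2 ^ gorder G / poly ?p (real (gorder G)) \<le> real t"
      unfolding G using time[OF k] by blast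
  qed
qed

end
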